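(* Let $p$ be an odd prime, $q$ a power of $p$, $\xi$ a generator of $\mathbb F_q^*$, $\ell$ an odd prime with $\ell\ne p$ and $\ell\mid q-1$, and $m,n$ positive integers. Let $u$ be such that $\ell^u$ exactly divides $q-1$, $v=\min\{m,u\}$ and $\zeta=\xi^{(q-1)/\ell^v}$. Let $\lambda\in\mathbb F_q^*$ and let $C$ be a $\lambda$-constacyclic code of length $2\ell^mp^n$ over $\mathbb F_q$. Then one of the following holds (empty products are $1$). (I) $\lambda\in\langle\xi^{2\ell^v}\rangle$. Then $c_1^{2\ell^mp^n}\lambda=1$ for some $c_1\in\mathbb F_q^*$, and $$C=\Big\langle\prod_{i=0}^{\ell^v-1}(X-c_1^{-1}\zeta^i)^{\varepsilon_i}(X+c_1^{-1}\zeta^i)^{\epsilon_i}\cdot\prod_{j=1}^{m-u}\prod_{\substack{k=1\\ \ell\nmid k}}^{\ell^v}(X^{\ell^j}-c_1^{-\ell^j}\zeta^k)^{\tau_k^j}(X^{\ell^j}+c_1^{-\ell^j}\zeta^k)^{\sigma_k^j}\Big\rangle$$ for some integers $0\le\varepsilon_i,\epsilon_i,\tau_k^j,\sigma_k^j\le p^n$. (II) $\lambda\in\xi^{\ell^vp^n}\langle\xi^{2\ell^v}\rangle$. Then $c_2^{2\ell^mp^n}\lambda=\xi^{\ell^vp^n}$ for some $c_2\in\mathbb F_q^*$, and: (II.A) if $m\le u$, then $C=\big\langle\prod_{i=0}^{\ell^m-1}(X^2-c_2^{-2}\xi\alpha^i)^{\varepsilon_i}\big\rangle$ for some integers $0\le\varepsilon_i\le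 p^n$, where $\alpha=\xi^{(q-1)/\ell^m}$; (II.B) if $m>u$, then $$C=\Big\langle\prod_{i=0}^{\ell^u-1}(X^2-c_2^{-2}\beta^{-1}\zeta^i)^{\varepsilon_i}\cdot\prod_{j=1}^{m-u}\prod_{\substack{k=1\\ \ell\nmid k}}^{\ell^u}(X^{2\ell^j}-c_2^{-2\ell^j}\beta^{-\ell^j}\zeta^k)^{\sigma_k^j}\Big\rangle$$ for some integers $0\le\varepsilon_i,\sigma_k^j\le p^n$, where $\beta$ is the element of $\langle\xi^{\ell^u}\rangle$ with $\beta^{\ell^m}\xi^{\ell^u}=1$. (III) $\lambda\in\xi^{jp^n}\langle\xi^{2\ell^v}\rangle$ for some $1\le j\le 2\ell^v-1$ with $j\ne\ell^v$. Then $d_1^{2\ell^mp^n}\lambda=\xi^{jp^n}$ for some $d_1\in\mathbb F_q^*$; write $j=y\ell^z$ with $\gcd(y,\ell)=1$, $0\le z\le v-1$, and let $\delta=\xi^{(q-1)/\ell^z}$. Then: (III.A) if $y$ is odd, $C=\big\langle\prod_{i=0}^{\ell^z-1}(X^{2\ell^{m-z}}-d_1^{-2\ell^{m-z}}\delta^i\xi^y)^{\varepsilon_i}\big\rangle$ for some integers $0\le\varepsilon_i\le p^n$; (III.B) if $y=2y_0$ is even, $C=\big\langle\prod_{i=0}^{\ell^z-1}(X^{\ell^{m-z}}-d_1^{-\ell^{m-z}}\delta^i\xi^{y_0})^{\varepsilon_i}(X^{\ell^{m-z}}+d_1^{-\ell^{m-z}}\delta^i\xi^{y_0})^{\epsilon_i}\big\rangle$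 for some integers $0\le\varepsilon_i,\epsilon_i\le p^n$.
   Context: For $\mu\in\mathbb F_q^*$, a $\mu$-constacyclic code of length $N$ over $\mathbb F_q$ is a linear subspace of $\mathbb F_q^N$ closed under $(c_0,\dots,c_{N-1})\mapsto(\mu c_{N-1},c_0,\dots,c_{N-2})$; such codes are identified with ideals of $\mathbb F_q[X]/\langle X^N-\mu\rangle$, and $\langle g(X)\rangle$ denotes the ideal generated by the image of $g(X)$. $\langle\xi^k\rangle$ denotes the subgroup of $\mathbb F_q^*$ generated by $\xi^k$, and $\xi^s\langle\xi^k\rangle$ its coset. *)

theory Defs
  imports "HOL-Computational_Algebra.Polynomial"
begin

text \<open>Vectors of length N over a field are lists of length N; position i is c_i.\<close>

definition constashift :: "'a::field \<Rightarrow> 'a list \<Rightarrow> 'a list" where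
  "constashift \<mu> c = (if c = [] then [] else (\<mu> * last c) # butlast c)"

definition constacyclic_code :: "'a::field \<Rightarrow> nat \<Rightarrow> 'a list set \<Rightarrow> bool" where
  "constacyclic_code \<mu> N C \<longleftrightarrow>
     C \<subseteq> {c. length c = N} \<and>
     replicate N 0 \<in> C \<and>
     (\<forall>a\<in>C. \<forall>b\<in>C. map2 (+) a b \<in> C) \<and>
     (\<forall>r. \<forall>a\<in>C. map ((*) r) a \<in> C) \<and>
     (\<forall>c\<in>C. constashift \<mu> c \<in> C)"

text \<open>The code identified with the ideal generated by g in F[X]/(X^N - mu):
  a vector c_0..c_{N-1} corresponds to the residue of c_0 + c_1 X + ... + c_{N-1} X^{N-1}.\<close>
definition gen_code :: "'a::field \<Rightarrow> nat \<Rightarrow> 'a poly \<Rightarrow> 'a list set" where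
  "gen_code \<mu> N g = {c. length c = N \<and>
      (\<exists>f. Poly c = (f * g) mod (monom 1 N - [:\<mu>:]))}"

definition cyc :: "'a::field \<Rightarrow> 'a set" where
  "cyc g = {g ^ i | i. True}"

definition coset :: "'a::field \<Rightarrow> 'a \<Rightarrow> 'a set" where
  "coset h g = {h * x | x. x \<in> cyc g}"

end

theory Submission
  imports Defs "HOL-Computational_Algebra.Polynomial_Factorial" "HOL-Number_Theory.Cong"
begin

text \<open>A constacyclic code is the ideal generated by a divisor of X^N - lam, so it suffices to factor
  this polynomial. Writing lam = c^(-N) xi^(j p^n), Frobenius gives
  X^N - lam = (X^(2 l^m) - c^(-2 l^m) xi^j)^(p^n), and the roots of unity of l-power order in the
  field split the inner binomial into binomials of degree l^k or 2 l^k. These are irreducible because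
  their constant terms are not l-th powers, respectively neither l-th powers nor squares.\<close>

section \<open>Codes and their generator polynomials\<close>

text \<open>The number 2 l^v is gcd(N, q - 1), so N-th powers move lam exactly within a coset of the
  subgroup generated by xi^(2 l^v). As p is prime to q - 1, representatives xi^(j p^n) can be
  chosen, which is what makes the p^n-th power appear. The three cases record how far the inner
  binomial splits. If j = y l^z with l not dividing y and z < v, the l^z-th roots of unity split it
  once; they are l-th powers themselves, so xi^y blocks any further splitting. If l^v divides j,
  that is j = 0 or j = l^v, this obstruction is gone; for m > u the field then runs out of roots of
  unity of l-power order, and the roots zeta^k with l not dividing k become the obstruction, in m -
  u layers. The parity of j decides whether there is a difference of squares. Irreducibility is
  argued by divisibility by an irreducible f rather than inside the quotient field, and comes down
  to the prime powers dividing 1 + q + ... + q^(d-1). The delicate case 4 | t of the binomial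
  criterion never occurs here, since l is odd.\<close>

lemma Poly_eq_iff_same_length:
  assumes "length a = length b"
  shows "Poly a = Poly b \<longleftrightarrow> a = b"
proof
  assume eq: "Poly a = Poly b"
  show "a = b"
  proof (rule nth_equalityI)
    fix i assume "i < length a"
    then show "a ! i = b ! i"
      using arg_cong[OF eq, of "\<lambda>p. coeff p i"] assms by (simp add: nth_default_def)
  qed (fact assms)
qed simp

lemma degree_Poly_less: "0 < length c \<Longrightarrow> degree (Poly c) < length c"
  by (rule degree_lessI) (auto simp: nth_default_def)

lemma ex_Poly_of_length:
  fixes p :: "'a::zero poly"
  assumes "degree p < N"
  shows "\<exists>c. length c = N \<and> Poly c = p"
proof (intro exI conjI)
  show "Poly (map (coeff p) [0..<N]) = p"
    using assms by (intro poly_eqI) (auto simp: nth_default_def coeff_eq_0)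
qed simp

lemma degree_binomial:
  fixes a :: "'a::comm_ring_1"
  assumes "0 < N"
  shows "degree (monom 1 N - [:a:]) = N" "monom 1 N - [:a:] \<noteq> 0" "lead_coeff (monom 1 N - [:a:]) = 1"
proof -
  have c: "coeff (monom 1 N - [:a:]) N = 1"
    using assms by (simp add: coeff_pCons split: nat.split)
  have "degree (monom 1 N - [:a:]) \<le> N"
    by (rule degree_le) (auto simp: coeff_pCons split: nat.split)
  moreover have "N \<le> degree (monom 1 N - [:a:])"
    by (rule le_degree) (unfold c, simp)
  ultimately show d: "degree (monom 1 N - [:a:]) = N" by simp
  show "lead_coeff (monom 1 N - [:a:]) = 1"
    unfolding d by (rule c)
  show "monom 1 N - [:a:] \<noteq> 0"
    using c by force
qed

lemma Poly_map2_add: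
  "length a = length b \<Longrightarrow> Poly (map2 (+) a b) = Poly a + Poly (b :: 'a::field list)"
  by (rule poly_eqI) (auto simp: nth_default_def)

lemma Poly_map_mult: "Poly (map ((*) r) a) = smult r (Poly (a :: 'a::field list))"
  by (rule poly_eqI) (auto simp: nth_default_def)

text \<open>Multiplication by X pushes the last entry x to degree N; subtracting x times the modulus
  turns x X^N into mu x and leaves degree below N.\<close>

lemma Poly_constashift:
  fixes c :: "'a::field list"
  assumes "length c = N" "0 < N"
  shows "Poly (constashift \<mu> c) = pCons 0 (Poly c) mod (monom 1 N - [:\<mu>:])"
proof -
  obtain b x where c: "c = b @ [x]"
    using assms by (cases c rule: rev_cases) auto
  then have N: "N = Suc (length b)" using assms by simp
  have "Poly (constashift \<mu> c) = pCons (\<mu> * x) (Poly b)"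
    by (simp add: constashift_def c)
  moreover have "pCons 0 (Poly c) = pCons (\<mu> * x) (Poly b) + smult x (monom 1 N - [:\<mu>:])"
    by (rule poly_eqI)
      (auto simp: c N coeff_pCons nth_default_def nth_append split: nat.split)
  ultimately have eq: "pCons 0 (Poly c) = Poly (constashift \<mu> c) + smult x (monom 1 N - [:\<mu>:])"
    by simp
  have "degree (Poly (constashift \<mu> c)) < N"
    using degree_Poly_less[of "constashift \<mu> c"] by (simp add: constashift_def c N)
  then show ?thesis
    unfolding eq using degree_binomial(1)[OF assms(2), of \<mu>]
    by (simp add: poly_mod_add_left mod_poly_less mod_smult_left)
qed

text \<open>The preimage \<open>I\<close> of the code under reduction modulo \<open>M\<close> is an
  ideal of a Euclidean ring, so a nonzero element of least degree generates it. Since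
  \<open>M\<close> reduces to the zero word, \<open>M\<close> lies in \<open>I\<close> and the
  generator divides it.\<close>

lemma constacyclic_code_generator:
  fixes lam :: "'a::field"
  assumes "constacyclic_code lam N C" and N: "0 < N"
  shows "\<exists>g. g dvd monom 1 N - [:lam:] \<and> C = gen_code lam N g"
proof -
  define M where "M = monom 1 N - [:lam:]"
  have degM: "degree M = N" and M0: "M \<noteq> 0"
    using degree_binomial[OF N, of lam] by (simp_all add: M_def)
  define I where "I = {f. \<exists>c\<in>C. f mod M = Poly c}"
  have len: "length c = N" if "c \<in> C" for c
    using assms that by (auto simp: constacyclic_code_def)
  have mod_self: "Poly c mod M = Poly c" if "length c = N" for c
    using degree_Poly_less[of c] that N degM by (simp add: mod_poly_less)
  have add: "f + g \<in> I" if fg: "f \<in> I" "g \<in> I" for f g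
  proof -
    obtain a b where "a \<in> C" "b \<in> C" "f mod M = Poly a" "g mod M = Poly b"
      using fg unfolding I_def by blast
    moreover from this have "map2 (+) a b \<in> C"
      using assms by (auto simp: constacyclic_code_def)
    moreover from calculation have "(f + g) mod M = Poly (map2 (+) a b)"
      using len by (simp only: Poly_map2_add poly_mod_add_left)
    ultimately show ?thesis unfolding I_def by blast
  qed
  have smult: "smult r f \<in> I" if fg: "f \<in> I" for f r
  proof -
    obtain a where "a \<in> C" "f mod M = Poly a" using fg unfolding I_def by blast
    moreover from this have "map ((*) r) a \<in> C"
      using assms by (auto simp: constacyclic_code_def)
    moreover from calculation have "smult r f mod M = Poly (map ((*) r) a)"
      by (simp only: Poly_map_mult mod_smult_left)
    ultimately show ?thesis unfolding I_def by blast
  qed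
  have shift: "pCons 0 f \<in> I" if fg: "f \<in> I" for f
  proof -
    obtain a where a: "a \<in> C" "f mod M = Poly a" using fg unfolding I_def by blast
    then have "constashift lam a \<in> C"
      using assms by (auto simp: constacyclic_code_def)
    moreover have "pCons 0 f mod M = Poly (constashift lam a)"
    proof -
      have "pCons 0 f mod M = ([:0, 1:] * f) mod M" by simp
      also have "\<dots> = ([:0, 1:] * (f mod M)) mod M" by (rule mod_mult_right_eq [symmetric])
      also have "\<dots> = pCons 0 (Poly a) mod M" unfolding a(2) by simp
      finally show ?thesis
        unfolding M_def Poly_constashift[OF len[OF a(1)] N] .
    qed
    ultimately show ?thesis unfolding I_def by blast
  qed
  have zero: "0 \<in> I"
  proof -
    have "replicate N 0 \<in> C" using assms by (simp add: constacyclic_code_def)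
    moreover have "Poly (replicate N 0 :: 'a list) = 0"
      by (rule poly_eqI) (simp add: nth_default_def)
    ultimately show ?thesis unfolding I_def by (auto intro: bexI[of _ "replicate N 0"])
  qed
  \<comment> \<open>Horner's scheme h = a + X h' reduces closure under all multiples to sums,
    scalars and the shift.\<close>
  have mult: "h * f \<in> I" if "f \<in> I" for h f
  proof (induction h)
    case (pCons a h)
    show ?case unfolding mult_pCons_left by (intro add smult shift pCons.IH that)
  qed (simp add: zero)
  have MI: "M \<in> I"
    using zero by (simp add: I_def)
  define g where "g = (ARG_MIN degree f. f \<in> I \<and> f \<noteq> 0)"
  have gI: "g \<in> I" "g \<noteq> 0" and gmin: "\<And>f. f \<in> I \<Longrightarrow> f \<noteq> 0 \<Longrightarrow> degree g \<le> degree f"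
    using arg_min_nat_lemma[of "\<lambda>f. f \<in> I \<and> f \<noteq> 0" M degree] MI M0 by (auto simp: g_def)
  have dvd: "g dvd f" if "f \<in> I" for f
  proof -
    have eq: "f mod g = f + (- (f div g)) * g"
      by (simp add: minus_div_mult_eq_mod [symmetric])
    have "f mod g \<in> I"
      unfolding eq by (intro add mult gI that)
    then have "f mod g = 0"
      using gmin[of "f mod g"] degree_mod_less[OF gI(2), of f] by linarith
    then show ?thesis by (simp add: mod_eq_0_iff_dvd)
  qed
  have "C = gen_code lam N g"
  proof (intro set_eqI iffI)
    fix c assume c: "c \<in> C"
    then have "Poly c \<in> I"
      unfolding I_def using mod_self[OF len[OF c]] by blast
    then obtain f where "Poly c = g * f"
      using dvd by (meson dvdE)
    then have "Poly c = (f * g) mod M"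
      using mod_self[OF len[OF c]] by (simp only: mult.commute)
    then show "c \<in> gen_code lam N g"
      using len[OF c] unfolding gen_code_def M_def by blast
  next
    fix c assume "c \<in> gen_code lam N g"
    then obtain f where c: "length c = N" "Poly c = (f * g) mod M"
      unfolding gen_code_def M_def by blast
    from mult[OF gI(1), of f] obtain a where a: "a \<in> C" "(f * g) mod M = Poly a"
      unfolding I_def by blast
    have "Poly a = Poly c" by (simp only: a(2) [symmetric] c(2))
    then have "a = c"
      by (rule Poly_eq_iff_same_length[THEN iffD1, rotated]) (simp only: c(1) len[OF a(1)])
    then show "c \<in> C" using a(1) by simp
  qed
  then show ?thesis
    using dvd[OF MI] unfolding M_def by blast
qed

section \<open>Divisors of products of irreducible powers, up to units\<close>

lemma gen_code_mult_unit:
  assumes "is_unit h"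
  shows "gen_code lam N (g * h) = gen_code lam N g"
proof -
  obtain k where k: "1 = h * k" using assms by (rule dvdE)
  have 1: "f * g = (f * k) * (g * h)" for f
    using k by (metis mult.assoc mult.commute mult_1)
  have 2: "f * (g * h) = (f * h) * g" for f
    by (simp add: mult_ac)
  show ?thesis
    unfolding gen_code_def
  proof (intro Collect_cong conj_cong refl)
    fix c :: "'a list"
    show "(\<exists>f. Poly c = f * (g * h) mod (monom 1 N - [:lam:])) \<longleftrightarrow>
          (\<exists>f. Poly c = f * g mod (monom 1 N - [:lam:]))"
    proof (intro iffI; elim exE)
      fix f assume "Poly c = f * (g * h) mod (monom 1 N - [:lam:])"
      then show "\<exists>f. Poly c = f * g mod (monom 1 N - [:lam:])" unfolding 2 by (rule exI)
    next
      fix f assume "Poly c = f * g mod (monom 1 N - [:lam:])"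
      then show "\<exists>f. Poly c = f * (g * h) mod (monom 1 N - [:lam:])" unfolding 1[of f] by (rule exI)
    qed
  qed
qed

text \<open>If f divides g, one f is cancelled on both sides; if not, f is prime and so divides the
  cofactor of g, and K drops while g stays. The free factor \<open>h\<close> lets several
  irreducibles be peeled off in turn, so distinctness of the factors never enters.\<close>

lemma dvd_irreducible_power_mult:
  fixes f g h :: "'a::field poly"
  assumes "irreducible f" "g dvd f ^ K * h"
  shows "\<exists>e g'. e \<le> K \<and> g = f ^ e * g' \<and> g' dvd h"
  using assms(2)
proof (induction K arbitrary: g)
  case 0
  then show ?case by auto
next
  case (Suc K)
  have prime: "prime_elem f" by (rule field_poly_irreducible_imp_prime) fact
  have f0: "f \<noteq> 0" using prime by auto
  show ?case
  proof (cases "f dvd g")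
    case True
    then obtain g1 where g1: "g = f * g1" by auto
    with Suc.prems have "g1 dvd f ^ K * h" using f0 by (simp add: mult.assoc)
    from Suc.IH[OF this] obtain e g' where "e \<le> K" "g1 = f ^ e * g'" "g' dvd h" by auto
    then show ?thesis
      using g1 by (auto intro!: exI[of _ "Suc e"] exI[of _ g'] simp: mult.assoc)
  next
    case False
    obtain k where k: "f ^ Suc K * h = g * k" using Suc.prems by auto
    then have "f dvd g * k" by (metis dvd_triv_left mult.assoc power_Suc)
    then have "f dvd k" using prime False by (simp add: prime_elem_dvd_mult_iff)
    then obtain k' where "k = f * k'" by auto
    with k have "f * (f ^ K * h) = f * (g * k')" by (simp add: mult_ac)
    then have "g dvd f ^ K * h" using f0 by simp
    from Suc.IH[OF this] show ?thesis using le_SucI by blast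
  qed
qed

lemma dvd_prod_irreducible_power_mult:
  fixes f :: "'i \<Rightarrow> 'a::field poly"
  assumes "finite A" "\<And>i. i \<in> A \<Longrightarrow> irreducible (f i)" "g dvd (\<Prod>i\<in>A. f i ^ K) * h"
  shows "\<exists>e g'. (\<forall>i. e i \<le> K) \<and> g = (\<Prod>i\<in>A. f i ^ e i) * g' \<and> g' dvd h"
  using assms
proof (induction A arbitrary: g rule: finite_induct)
  case empty
  \<comment> \<open>The bound on the exponents is claimed for every index, also outside the index
    set; 0 is the default there.\<close>
  then show ?case by (auto intro!: exI[of _ "\<lambda>_. 0"])
next
  case (insert a A)
  have "g dvd f a ^ K * ((\<Prod>i\<in>A. f i ^ K) * h)"
    using insert by (simp add: mult.assoc)
  from dvd_irreducible_power_mult[OF insert.prems(1)[OF insertI1] this]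
  obtain e0 g0 where e0: "e0 \<le> K" "g = f a ^ e0 * g0" "g0 dvd (\<Prod>i\<in>A. f i ^ K) * h"
    by blast
  from insert.IH[OF insert.prems(1)[OF insertI2] e0(3)]
  obtain e g' where e: "\<forall>i. e i \<le> K" "g0 = (\<Prod>i\<in>A. f i ^ e i) * g'" "g' dvd h"
    by blast
  have "(\<Prod>i\<in>A. f i ^ (e(a := e0)) i) = (\<Prod>i\<in>A. f i ^ e i)"
    using insert.hyps by (intro prod.cong) auto
  then show ?case
    using e0(1,2) e insert.hyps
    by (intro exI[of _ "e(a := e0)"] exI[of _ g'] conjI) (simp_all add: mult.assoc)
qed

section \<open>Irreducible binomials over finite fields\<close>

lemma geometric_sum_mult:
  fixes q :: nat
  shows "(\<Sum>k<a * b. q ^ k) = (\<Sum>k<a. q ^ k) * (\<Sum>k<b. (q ^ a) ^ k)"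
proof (induction b)
  case (Suc b)
  have "(\<Sum>k<n + a. q ^ k) = (\<Sum>k<n. q ^ k) + q ^ n * (\<Sum>k<a. q ^ k)" for n
    by (induction a) (simp_all add: power_add algebra_simps)
  from this[of "a * b"] Suc show ?case
    by (simp add: algebra_simps power_mult)
qed simp

lemma geometric_sum_cong:
  fixes q :: nat
  assumes "[q = 1] (mod r)"
  shows "[(\<Sum>k<i. q ^ k) = i] (mod r)"
proof -
  have "[(\<Sum>k<i. q ^ k) = (\<Sum>k<i. 1)] (mod r)"
    using cong_pow[OF assms] by (intro cong_sum) simp
  then show ?thesis by simp
qed

text \<open>The prime r divides the sum exactly once. With q = 1 + r w, each q^k is 1 + k r w modulo
  r^2, and for odd r the linear terms add up to r w times r (r - 1) / 2, a multiple of r^2. For r =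
  2 the sum is 1 + q, whence the condition modulo 4.\<close>

lemma geometric_sum_prime_length:
  fixes q r :: nat
  assumes r: "prime r" and q: "[q = 1] (mod r)" "r = 2 \<Longrightarrow> [q = 1] (mod 4)" "0 < q"
  shows "\<exists>c. (\<Sum>k<r. q ^ k) = r * c \<and> coprime r c"
proof -
  have "r dvd q - 1" using q(1,3) by (simp add: cong_altdef_nat)
  then obtain w where "q - 1 = r * w" by auto
  then have w: "q = 1 + r * w" using q(3) by simp
  have "[(\<Sum>k<r. q ^ k) = r] (mod r ^ 2)"
  proof (cases "r = 2")
    case True
    with q(2) have "[1 + q = 1 + 1] (mod 4)" by (intro cong_add) auto
    then have "[1 + q = 2] (mod 4)" by (simp only: one_add_one)
    moreover have "(\<Sum>k<(2::nat). q ^ k) = 1 + q" by (simp add: numeral_2_eq_2)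
    ultimately show ?thesis using True by simp
  next
    case False
    then have "odd r" using r primes_dvd_imp_eq two_is_prime_nat by blast
    have pow: "[q ^ k = 1 + k * (r * w)] (mod r ^ 2)" for k
    proof (induction k)
      case (Suc k)
      have "[q * q ^ k = q * (1 + k * (r * w))] (mod r ^ 2)"
        by (intro cong_mult Suc.IH) simp
      also have "q * (1 + k * (r * w)) = 1 + Suc k * (r * w) + r ^ 2 * (k * w * w)"
        by (simp add: w algebra_simps power2_eq_square)
      also have "[\<dots> = 1 + Suc k * (r * w)] (mod r ^ 2)"
        by (simp add: cong_def)
      finally show ?case by simp
    qed simp
    obtain h where h: "r = 2 * h + 1" using \<open>odd r\<close> by (elim oddE)
    have gauss: "(\<Sum>k<2 * n + 1. k) = (2 * n + 1) * n" for n :: nat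
      by (induction n) auto
    have "(\<Sum>k<r. 1 + k * (r * w)) = r + (\<Sum>k<r. k) * (r * w)"
      unfolding sum.distrib sum_distrib_right by simp
    also have "(\<Sum>k<r. k) = r * h" unfolding h by (rule gauss)
    also have "r + r * h * (r * w) = r + r ^ 2 * (h * w)"
      by (simp add: power2_eq_square)
    finally have "(\<Sum>k<r. 1 + k * (r * w)) = r + r ^ 2 * (h * w)" .
    moreover have "[(\<Sum>k<r. q ^ k) = (\<Sum>k<r. 1 + k * (r * w))] (mod r ^ 2)"
      by (intro cong_sum pow)
    ultimately show ?thesis by (simp add: cong_def)
  qed
  then have c2: "(\<Sum>k<r. q ^ k) mod (r * r) = r mod (r * r)"
    by (simp add: cong_def power2_eq_square)
  have "r dvd (\<Sum>k<r. q ^ k)"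
    using geometric_sum_cong[OF q(1), of r] by (simp add: cong_def mod_eq_0_iff_dvd)
  then obtain c where c: "(\<Sum>k<r. q ^ k) = r * c" by auto
  have "\<not> r dvd c"
  proof
    assume "r dvd c"
    then have "r mod (r * r) = 0" using c2 c by auto
    then have "r * r dvd r" by auto
    then show False using r prime_gt_1_nat[OF r] by auto
  qed
  then show ?thesis using c r by (auto simp: prime_imp_coprime)
qed

text \<open>Splitting a sum of length r i' into blocks of length r leaves r c times the sum of
  length i' for the base q^r, with c prime to r, so each step removes one r from both sides. The
  base changes to q^r, so the induction must range over q as well.\<close>

lemma prime_power_dvd_geometric_sum:
  fixes q r :: nat
  assumes r: "prime r" and q: "[q = 1] (mod r)" "r = 2 \<Longrightarrow> [q = 1] (mod 4)" "0 < q"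
    and "r ^ k dvd (\<Sum>j<i. q ^ j)"
  shows "r ^ k dvd i"
  using assms(2-)
proof (induction k arbitrary: i q)
  case (Suc k)
  have r0: "r \<noteq> 0" using r by auto
  have "r dvd (\<Sum>j<i. q ^ j)" using Suc.prems(4) by (metis dvd_mult_left power_Suc)
  then have "r dvd i"
    using geometric_sum_cong[OF Suc.prems(1), of i] cong_dvd_iff by blast
  then obtain i' where i': "i = r * i'" by auto
  obtain c where c: "(\<Sum>k<r. q ^ k) = r * c" "coprime r c"
    using geometric_sum_prime_length[OF r] Suc.prems by blast
  have "r * r ^ k dvd r * (c * (\<Sum>j<i'. (q ^ r) ^ j))"
    using Suc.prems(4) unfolding i' geometric_sum_mult c(1) by (simp add: mult.assoc)
  then have "r ^ k dvd c * (\<Sum>j<i'. (q ^ r) ^ j)"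
    using r0 by simp
  then have "r ^ k dvd (\<Sum>j<i'. (q ^ r) ^ j)"
    using c(2) by (simp add: coprime_dvd_mult_right_iff)
  moreover have "[q ^ r = 1] (mod r)" "r = 2 \<Longrightarrow> [q ^ r = 1] (mod 4)"
    using cong_pow[OF Suc.prems(1), of r] cong_pow[OF Suc.prems(2), of r] by simp_all
  ultimately have "r ^ k dvd i'"
    using Suc.IH[of "q ^ r" i'] Suc.prems(3) by simp
  then show ?case using i' by simp
qed simp

lemma dvd_geometric_sum:
  fixes q t :: nat
  assumes "0 < t" "0 < i" "0 < q"
    and pr: "\<And>r. prime r \<Longrightarrow> r dvd t \<Longrightarrow> [q = 1] (mod r)"
    and four: "4 dvd t \<Longrightarrow> [q = 1] (mod 4)"
    and dvd: "t dvd (\<Sum>j<i. q ^ j)"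
  shows "t dvd i"
proof (rule multiplicity_le_imp_dvd)
  fix r :: nat assume r: "prime r"
  define k where "k = multiplicity r t"
  have "r ^ k dvd i"
  proof (cases "k = 0")
    case False
    have kt: "r ^ k dvd t" by (simp add: k_def multiplicity_dvd)
    then have kS: "r ^ k dvd (\<Sum>j<i. q ^ j)" using dvd by (rule dvd_trans)
    have "r dvd t" using kt False by (meson dvd_power dvd_trans neq0_conv)
    then have q: "[q = 1] (mod r)" using pr r by simp
    show ?thesis
    \<comment> \<open>If 2 divides t only once, nothing is known about q modulo 4, but the sum has
      the parity of i and that suffices.\<close>
    proof (cases "r = 2 \<and> k = 1")
      case True
      then show ?thesis using kS geometric_sum_cong[OF q, of i] cong_dvd_iff by auto
    next
      case False
      have "[q = 1] (mod 4)" if "r = 2"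
      proof -
        have "2 \<le> k" using False \<open>k \<noteq> 0\<close> that by auto
        then have "r ^ 2 dvd t" using kt le_imp_power_dvd dvd_trans by blast
        then show ?thesis using four that by simp
      qed
      from prime_power_dvd_geometric_sum[OF r q this \<open>0 < q\<close> kS] show ?thesis .
    qed
  qed simp
  then show "multiplicity r t \<le> multiplicity r i"
    using r assms(2) prime_gt_1_nat[OF r]
    by (intro multiplicity_geI) (auto simp: k_def)
qed (use assms in simp)

section \<open>Fermat's theorem modulo an irreducible polynomial\<close>

lemma card_degree_less:
  assumes "0 < d"
  shows "finite {r :: 'a::{finite,field} poly. degree r < d}"
    and "card {r :: 'a poly. degree r < d} = card (UNIV :: 'a set) ^ d"
proof -
  define L where "L = {xs :: 'a list. set xs \<subseteq> UNIV \<and> length xs = d}"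
  have img: "{r :: 'a poly. degree r < d} = Poly ` L"
    using ex_Poly_of_length[of _ d] degree_Poly_less assms by (fastforce simp: L_def)
  have inj: "inj_on Poly L"
    by (rule inj_onI) (auto simp: L_def Poly_eq_iff_same_length)
  show "finite {r :: 'a poly. degree r < d}"
    unfolding img L_def by (intro finite_imageI finite_lists_length_eq) simp
  show "card {r :: 'a poly. degree r < d} = card (UNIV :: 'a set) ^ d"
    unfolding img card_image[OF inj] unfolding L_def by (rule card_lists_length_eq) simp
qed

text \<open>Multiplication by x permutes the nonzero residues \<open>R\<close> modulo f. Comparing
  the product over \<open>R\<close> before and after the permutation gives x^(card R) = 1 once that
  product, which is prime to f, is cancelled.\<close>

lemma fermat_irreducible_poly:
  fixes f x :: "'a::{finite,field} poly"
  assumes f: "irreducible f" and x: "\<not> f dvd x"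
  shows "f dvd x ^ (card (UNIV :: 'a set) ^ degree f - 1) - 1"
proof -
  have prime: "prime_elem f" by (rule field_poly_irreducible_imp_prime) fact
  have f0: "f \<noteq> 0" using prime by auto
  have d: "0 < degree f"
    using f f0 by (metis irreducible_not_unit is_unit_iff_degree neq0_conv)
  define R where "R = {r :: 'a poly. degree r < degree f} - {0}"
  have fin: "finite R" and card: "card R = card (UNIV :: 'a set) ^ degree f - 1"
    using card_degree_less[OF d, where 'a = 'a] d by (simp_all add: R_def card_Diff_singleton)
  have ndvd: "\<not> f dvd r" if "r \<in> R" for r
    using that by (auto simp: R_def dest!: dvd_imp_degree_le)
  define \<phi> where "\<phi> r = (x * r) mod f" for r
  have inj: "inj_on \<phi> R"
  proof (rule inj_onI)
    fix r s assume rs: "r \<in> R" "s \<in> R" "\<phi> r = \<phi> s"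
    then have "f dvd x * (r - s)"
      by (simp add: \<phi>_def mod_eq_dvd_iff right_diff_distrib)
    then have "f dvd r - s" using prime x by (simp add: prime_elem_dvd_mult_iff)
    moreover have "degree (r - s) < degree f"
      using rs by (intro degree_diff_less) (auto simp: R_def)
    ultimately show "r = s"
      by (metis dvd_imp_degree_le eq_iff_diff_eq_0 not_le)
  qed
  moreover have "\<phi> ` R \<subseteq> R"
  proof
    fix y assume "y \<in> \<phi> ` R"
    then obtain r where r: "r \<in> R" "y = (x * r) mod f" by (auto simp: \<phi>_def)
    then have "\<not> f dvd x * r" using ndvd prime x by (simp add: prime_elem_dvd_mult_iff)
    then have "y \<noteq> 0" using r by (simp add: mod_eq_0_iff_dvd)
    then show "y \<in> R" using r degree_mod_less[OF f0, of "x * r"] by (simp add: R_def)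
  qed
  ultimately have "\<phi> ` R = R" using fin by (simp add: endo_inj_surj)
  then have "(\<Prod>r\<in>R. r) = (\<Prod>r\<in>R. \<phi> r)"
    using prod.reindex[OF inj, of id] by simp
  then have "(\<Prod>r\<in>R. r) mod f = (\<Prod>r\<in>R. \<phi> r) mod f" by simp
  also have "\<dots> = (\<Prod>r\<in>R. x * r) mod f"
    unfolding \<phi>_def by (rule mod_prod_eq)
  also have "(\<Prod>r\<in>R. x * r) = x ^ card R * (\<Prod>r\<in>R. r)"
    by (simp add: prod.distrib)
  finally have "f dvd x ^ card R * (\<Prod>r\<in>R. r) - (\<Prod>r\<in>R. r)"
    by (metis mod_eq_dvd_iff)
  also have "x ^ card R * (\<Prod>r\<in>R. r) - (\<Prod>r\<in>R. r) = (x ^ card R - 1) * (\<Prod>r\<in>R. r)"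
    by (simp add: left_diff_distrib)
  finally have "f dvd x ^ card R - 1 \<or> f dvd (\<Prod>r\<in>R. r)"
    using prime by (simp add: prime_elem_dvd_mult_iff)
  moreover have "\<not> f dvd (\<Prod>r\<in>R. r)"
  proof -
    have "\<not> f dvd (\<Prod>r\<in>T. r)" if "T \<subseteq> R" for T
      using finite_subset[OF that fin] that
    proof (induction T rule: finite_induct)
      case empty
      then show ?case using prime by auto
    next
      case (insert r T)
      then show ?case using ndvd[of r] prime by (simp add: prime_elem_dvd_mult_iff)
    qed
    then show ?thesis by blast
  qed
  ultimately show ?thesis by (simp add: card)
qed

lemma ex_irreducible_factor:
  fixes p :: "'a::field poly"
  assumes "p \<noteq> 0" "\<not> is_unit p"
  shows "\<exists>f. irreducible f \<and> f dvd p"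
  using assms
proof (induction "degree p" arbitrary: p rule: less_induct)
  case less
  show ?case
  proof (cases "irreducible p")
    case False
    then obtain a b where ab: "p = a * b" "\<not> is_unit a" "\<not> is_unit b"
      using less.prems by (auto simp: irreducible_def)
    then have "a \<noteq> 0" "b \<noteq> 0" using less.prems by auto
    moreover from this have "0 < degree b" using ab by (simp add: is_unit_iff_degree)
    ultimately have "degree a < degree p" by (simp add: ab(1) degree_mult_eq)
    with less.hyps[of a] \<open>a \<noteq> 0\<close> ab show ?thesis by (metis dvd_mult2)
  qed auto
qed

text \<open>Bezout in the natural numbers, a m = b k + gcd a b, replaces any talk of the order of y
  modulo f.\<close>

lemma dvd_power_gcd_minus_1:
  fixes f y :: "'a::comm_ring_1"
  assumes "f dvd y ^ a - 1" "f dvd y ^ b - 1" "a \<noteq> 0"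
  shows "f dvd y ^ gcd a b - 1"
proof -
  have mult: "f dvd y ^ (n * k) - 1" if "f dvd y ^ n - 1" for n k
  proof -
    have "y ^ n - 1 dvd (y ^ n) ^ k - 1"
      using power_diff_1_eq[of "y ^ n" k] by (metis dvd_triv_left)
    with that show ?thesis by (metis dvd_trans power_mult)
  qed
  obtain m k where mk: "a * m = b * k + gcd a b"
    using bezout_nat[OF assms(3)] by blast
  have "y ^ (b * k + gcd a b) - 1 - y ^ gcd a b * (y ^ (b * k) - 1) = y ^ gcd a b - 1"
    by (simp add: power_add algebra_simps)
  moreover have "f dvd y ^ (b * k + gcd a b) - 1 - y ^ gcd a b * (y ^ (b * k) - 1)"
    using mult[OF assms(1), of m] mult[OF assms(2), of k] unfolding mk
    by (metis dvd_diff dvd_mult)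
  ultimately show ?thesis by metis
qed

text \<open>Modulo an irreducible factor of degree d of the binomial, y = X^(q-1) has multiplicative
  order exactly t. By Fermat this order divides 1 + q + ... + q^(d-1), hence t divides d.\<close>

lemma irreducible_binomial:
  fixes a :: "'a::{finite,field}"
  defines "q \<equiv> card (UNIV :: 'a set)"
  assumes t: "0 < t" and a: "a \<noteq> 0" "a ^ (q - 1) = 1"
    and pr: "\<And>r. prime r \<Longrightarrow> r dvd t \<Longrightarrow> r dvd q - 1 \<and> a ^ ((q - 1) div r) \<noteq> 1"
    and four: "4 dvd t \<Longrightarrow> 4 dvd q - 1"
  shows "irreducible (monom 1 t - [:a:])"
proof -
  define M where "M = monom 1 t - [:a:]"
  have degM: "degree M = t" and M0: "M \<noteq> 0"
    using degree_binomial[OF t, of a] by (simp_all add: M_def)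
  define X where "X = [:0, 1 :: 'a:]"
  have Mt: "M = X ^ t - [:a:]" by (simp add: M_def X_def monom_altdef)
  have q1: "0 < q" by (simp add: q_def card_gt_0_iff)
  have pow: "M dvd X ^ (t * n) - [:a ^ n:]" for n
  proof -
    have "X ^ t - [:a:] dvd (X ^ t) ^ n - [:a:] ^ n"
      using power_diff_sumr2[of "X ^ t" n "[:a:]"] by simp
    then show ?thesis by (simp add: Mt power_mult poly_const_pow)
  qed
  \<comment> \<open>This is enough: in a factorization of \<open>M\<close> into two nonunits, an
    irreducible factor of the first would already use up the whole degree t.\<close>
  have key: "t \<le> degree f" if f: "irreducible f" "f dvd M" for f
  proof -
    define d where "d = degree f"
    have f0: "f \<noteq> 0" and nu: "\<not> is_unit f" using f by (auto simp: irreducible_def)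
    have d: "0 < d" using nu f0 by (simp add: d_def is_unit_iff_degree)
    have nconst: "\<not> f dvd [:c:]" if "c \<noteq> 0" for c
      using that nu by (metis dvd_trans is_unit_const_poly_iff is_unit_triv)
    have "\<not> f dvd X"
    proof
      assume "f dvd X"
      then have "f dvd X ^ t" using t by (simp add: dvd_power_iff dvd_trans[OF _ dvd_power])
      then have "f dvd X ^ t - M" using f(2) by (rule dvd_diff)
      then show False using nconst[OF a(1)] by (simp add: Mt)
    qed
    define y where "y = X ^ (q - 1)"
    \<comment> \<open>\<open>S\<close> equals (q^d - 1) / (q - 1), so y^S = X^(q^d - 1).\<close>
    define S where "S = (\<Sum>k<d. q ^ k)"
    have "(q - 1) * S = q ^ d - 1"
    proof -
      have "int ((q - 1) * S) = (int q - 1) * (\<Sum>k<d. int q ^ k)"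
        using q1 by (simp add: S_def of_nat_diff)
      also have "\<dots> = int (q ^ d - 1)"
        using power_diff_1_eq[of "int q" d] q1 by (simp add: of_nat_diff)
      finally show ?thesis by linarith
    qed
    then have yS: "f dvd y ^ S - 1"
      using fermat_irreducible_poly[OF f(1) \<open>\<not> f dvd X\<close>]
      by (simp add: y_def d_def q_def flip: power_mult)
    have yt: "f dvd y ^ t - 1"
      using dvd_trans[OF f(2) pow[of "q - 1"]] a by (simp add: y_def mult.commute flip: power_mult one_pCons)
    define g where "g = gcd t S"
    have yg: "f dvd y ^ g - 1"
      unfolding g_def using yt yS t by (intro dvd_power_gcd_minus_1) auto
    obtain h where h: "t = g * h" by (metis dvdE g_def gcd_dvd1)
    \<comment> \<open>A prime r dividing h = t / g would give y^(t/r) = 1 modulo f, while y^(t/r) =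
      X^(t (q-1)/r) is a^((q-1)/r) modulo f. A nonunit f divides no nonzero constant, so a^((q-1)/r)
      = 1, against \<open>pr\<close>.\<close>
    have "h = 1"
    proof (rule ccontr)
      assume "h \<noteq> 1"
      then obtain r where r: "prime r" "r dvd h" using prime_factor_nat by blast
      then obtain h' where h': "h = r * h'" by auto
      have "r dvd t" using h r by simp
      from pr[OF r(1) this] obtain w where w: "q - 1 = r * w" "a ^ ((q - 1) div r) \<noteq> 1"
        by (metis dvdE)
      have r0: "r \<noteq> 0" using r by auto
      have "y ^ g - 1 dvd (y ^ g) ^ h' - 1"
        using power_diff_1_eq[of "y ^ g" h'] by (metis dvd_triv_left)
      then have 1: "f dvd (y ^ g) ^ h' - 1" using yg dvd_trans by blast
      have "(y ^ g) ^ h' = X ^ (t * w)"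
        unfolding y_def w(1) by (simp add: h h' mult_ac flip: power_mult)
      moreover have "f dvd X ^ (t * w) - [:a ^ w:]" using dvd_trans[OF f(2) pow] .
      ultimately have "f dvd (X ^ (t * w) - 1) - (X ^ (t * w) - [:a ^ w:])"
        using dvd_diff[OF 1, of "X ^ (t * w) - [:a ^ w:]"] by simp
      also have "(X ^ (t * w) - 1) - (X ^ (t * w) - [:a ^ w:]) = [:a ^ w - 1:]"
        by (simp add: one_pCons)
      finally have "f dvd [:a ^ w - 1:]" .
      moreover have "(q - 1) div r = w" unfolding w(1) using r0 by simp
      ultimately show False using nconst[of "a ^ w - 1"] w(2) by simp
    qed
    then have "t dvd S" using h g_def by (metis gcd_dvd2 mult.right_neutral)
    have cong1: "[q = 1] (mod r)" if "r dvd q - 1" for r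
      using that q1 by (simp add: cong_altdef_nat)
    have "t dvd d"
    proof (rule dvd_geometric_sum[OF t d q1])
      show "t dvd (\<Sum>j<d. q ^ j)" using \<open>t dvd S\<close> by (simp only: S_def)
    qed (use cong1 pr four in blast)+
    then show ?thesis using d by (simp add: d_def dvd_imp_le)
  qed
  show ?thesis
    unfolding M_def[symmetric]
  proof (rule irreducibleI)
    show "\<not> is_unit M" using degM M0 t by (simp add: is_unit_iff_degree)
    fix A B assume AB: "M = A * B"
    then have nz: "A \<noteq> 0" "B \<noteq> 0" using M0 by auto
    show "is_unit A \<or> is_unit B"
    proof (rule ccontr)
      assume nu: "\<not> (is_unit A \<or> is_unit B)"
      obtain f where f: "irreducible f" "f dvd A" using ex_irreducible_factor nz nu by blast
      then have "t \<le> degree f" using key AB by simp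
      also have "\<dots> \<le> degree A" using f nz by (simp add: dvd_imp_degree_le)
      finally have "degree B = 0"
        using degM AB nz by (simp add: degree_mult_eq)
      then show False using nu nz by (simp add: is_unit_iff_degree)
    qed
  qed (fact M0)
qed

section \<open>Factorization of binomials by roots of unity\<close>

lemma dvd_prod_prod_irreducible_power_mult:
  fixes f :: "'i \<Rightarrow> 'j \<Rightarrow> 'a::field poly"
  assumes "finite A" "finite B" "\<And>i j. i \<in> A \<Longrightarrow> j \<in> B \<Longrightarrow> irreducible (f i j)"
    "g dvd (\<Prod>i\<in>A. \<Prod>j\<in>B. f i j ^ K) * h"
  shows "\<exists>e g'. (\<forall>i j. e i j \<le> K) \<and> g = (\<Prod>i\<in>A. \<Prod>j\<in>B. f i j ^ e i j) * g' \<and> g' dvd h"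
proof -
  have "g dvd (\<Prod>x\<in>A \<times> B. f (fst x) (snd x) ^ K) * h"
    using assms(4) by (simp add: prod.cartesian_product split_def)
  then have "\<exists>e g'. (\<forall>x. e x \<le> K) \<and> g = (\<Prod>x\<in>A \<times> B. f (fst x) (snd x) ^ e x) * g' \<and> g' dvd h"
    by (rule dvd_prod_irreducible_power_mult[rotated 2]) (use assms in auto)
  then obtain e g' where e: "\<forall>x. e x \<le> K" "g = (\<Prod>x\<in>A \<times> B. f (fst x) (snd x) ^ e x) * g'" "g' dvd h"
    by blast
  have "(\<Prod>x\<in>A \<times> B. f (fst x) (snd x) ^ e x) = (\<Prod>i\<in>A. \<Prod>j\<in>B. f i j ^ e (i, j))"
    by (simp add: prod.cartesian_product split_def)
  then show ?thesis
    using e by (intro exI[of _ "\<lambda>i j. e (i, j)"] exI[of _ g']) simp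
qed

text \<open>Both sides are monic of degree t and vanish at the t points b w^i. These are distinct
  only for nonzero b, hence the separate case. The hypothesis on \<open>w\<close> says that it has
  order exactly t.\<close>

lemma prod_linear_roots_of_unity:
  fixes b w :: "'a::field"
  assumes t: "0 < t" and w: "\<And>k. w ^ k = 1 \<longleftrightarrow> t dvd k"
  shows "(\<Prod>i<t. [:- (b * w ^ i), 1:]) = monom 1 t - [:b ^ t:]"
proof (cases "b = 0")
  case True
  then show ?thesis using t by (simp add: monom_altdef)
next
  case False
  have w0: "w \<noteq> 0" using w[of t] t by (auto simp: power_0_left)
  have inj: "inj_on (\<lambda>i. b * w ^ i) {..<t}"
  proof (rule linorder_inj_onI')
    fix i j assume ij: "i \<in> {..<t}" "j \<in> {..<t}" "i < j"
    then have "w ^ (j - i) \<noteq> 1" using w[of "j - i"] by (auto dest: dvd_imp_le)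
    moreover have "w ^ j = w ^ i * w ^ (j - i)" using ij by (simp flip: power_add)
    ultimately show "b * w ^ i \<noteq> b * w ^ j" using False w0 by simp
  qed
  have deg: "degree (\<Prod>i<t. [:- (b * w ^ i), 1:]) = t"
    by (subst degree_prod_eq_sum_degree) auto
  have lead: "coeff (\<Prod>i<t. [:- (b * w ^ i), 1:]) t = 1"
    using lead_coeff_prod[of "\<lambda>i. [:- (b * w ^ i), 1:]" "{..<t}"] unfolding deg by simp
  show ?thesis
  proof (rule poly_eqI_degree_lead_coeff[where n = t and A = "(\<lambda>i. b * w ^ i) ` {..<t}"])
    show "coeff (\<Prod>i<t. [:- (b * w ^ i), 1:]) t = coeff (monom 1 t - [:b ^ t:]) t"
      using lead degree_binomial(1,3)[OF t, of "b ^ t"] by simp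
    fix z assume "z \<in> (\<lambda>i. b * w ^ i) ` {..<t}"
    then obtain i where i: "i < t" "z = b * w ^ i" by auto
    then have "(b * w ^ i) ^ t = b ^ t"
      using w[of "i * t"] by (simp add: power_mult_distrib flip: power_mult)
    then show "poly (\<Prod>i<t. [:- (b * w ^ i), 1:]) z = poly (monom 1 t - [:b ^ t:]) z"
      using i by (auto simp: poly_prod poly_monom)
  qed (use inj deg degree_binomial(1)[OF t, of "b ^ t"] in \<open>simp_all add: card_image\<close>)
qed

lemma pcompose_power: "pcompose (p ^ n) q = pcompose p q ^ n"
  by (induction n) (simp_all add: pcompose_1 pcompose_mult)

text \<open>Substituting Y for X in the linear case; the later uses take for Y a power of X.\<close>

lemma prod_roots_of_unity:
  fixes b w :: "'a::field" and Y :: "'a poly"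
  assumes t: "0 < t" and w: "\<And>k. w ^ k = 1 \<longleftrightarrow> t dvd k"
  shows "(\<Prod>i<t. Y - [:b * w ^ i:]) = Y ^ t - [:b ^ t:]"
proof -
  have "pcompose (\<Prod>i<t. [:- (b * w ^ i), 1:]) Y = (\<Prod>i<t. Y - [:b * w ^ i:])"
    by (simp add: pcompose_prod pcompose_pCons diff_conv_add_uminus add.commute del: add_uminus_conv_diff)
  moreover have "pcompose (monom 1 t - [:b ^ t:]) Y = Y ^ t - [:b ^ t:]"
    by (simp add: pcompose_diff monom_altdef pcompose_power pcompose_pCons)
  ultimately show ?thesis
    using prod_linear_roots_of_unity[OF assms] by metis
qed

text \<open>Starting the index at 1 amounts to replacing b by b w, which has the same t-th power.
  The upper layers are indexed from 1.\<close>

lemma prod_roots_of_unity_shifted: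
  fixes b w :: "'a::field" and Y :: "'a poly"
  assumes t: "0 < t" and w: "\<And>k. w ^ k = 1 \<longleftrightarrow> t dvd k"
  shows "(\<Prod>i\<in>{1..t}. Y - [:b * w ^ i:]) = Y ^ t - [:b ^ t:]"
proof -
  have "(\<Prod>i\<in>{1..t}. Y - [:b * w ^ i:]) = (\<Prod>i<t. Y - [:b * w ^ Suc i:])"
    by (rule prod.reindex_bij_witness[of _ Suc "\<lambda>i. i - 1"]) auto
  also have "\<dots> = (\<Prod>i<t. Y - [:(b * w) * w ^ i:])"
    by (simp add: mult.assoc)
  also have "\<dots> = Y ^ t - [:(b * w) ^ t:]" by (rule prod_roots_of_unity) fact+
  also have "(b * w) ^ t = b ^ t" using w[of t] by (simp add: power_mult_distrib)
  finally show ?thesis .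
qed

text \<open>The roots of unity whose exponent is a multiple of l contribute the binomial of the next
  lower level, so only the exponents prime to l survive at each level above the bottom one.\<close>

lemma prod_roots_of_unity_prime_power:
  fixes b w :: "'a::field" and Y :: "'a poly"
  assumes l: "prime l" and v: "0 < v" and w: "\<And>k. w ^ k = 1 \<longleftrightarrow> l ^ v dvd k"
  shows "(\<Prod>i<l ^ v. Y - [:b * w ^ i:]) *
      (\<Prod>j\<in>{1..d}. \<Prod>k\<in>{k\<in>{1..l ^ v}. \<not> l dvd k}. Y ^ (l ^ j) - [:b ^ (l ^ j) * w ^ k:])
    = Y ^ (l ^ (v + d)) - [:b ^ (l ^ (v + d)):]"
proof (induction d)
  case 0
  then show ?case using prod_roots_of_unity[OF _ w, of Y b] l by (simp add: prime_gt_0_nat)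
next
  case (Suc d)
  define f where "f k = Y ^ (l ^ Suc d) - [:b ^ (l ^ Suc d) * w ^ k:]" for k
  have l0: "0 < l" using l by (rule prime_gt_0_nat)
  obtain v' where v': "v = Suc v'" using v gr0_implies_Suc by blast
  \<comment> \<open>Exponents divisible by l are powers of w^l, whose order is l^(v-1); this is
    where v > 0 matters.\<close>
  have wl: "(w ^ l) ^ k = 1 \<longleftrightarrow> l ^ v' dvd k" for k
    using w[of "l * k"] l0 by (simp add: v' flip: power_mult)
  have "(\<Prod>k\<in>{k\<in>{1..l ^ v}. l dvd k}. f k) = (\<Prod>k\<in>{1..l ^ v'}. f (l * k))"
    by (rule prod.reindex_bij_witness[of _ "\<lambda>k. l * k" "\<lambda>k. k div l"]) (use l0 in \<open>auto simp: v'\<close>)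
  also have "\<dots> = (\<Prod>k\<in>{1..l ^ v'}. Y ^ (l ^ Suc d) - [:b ^ (l ^ Suc d) * (w ^ l) ^ k:])"
    by (simp add: f_def power_mult)
  also have "\<dots> = (Y ^ (l ^ Suc d)) ^ (l ^ v') - [:(b ^ (l ^ Suc d)) ^ (l ^ v'):]"
    using l0 wl by (intro prod_roots_of_unity_shifted) auto
  also have "\<dots> = Y ^ (l ^ (v + d)) - [:b ^ (l ^ (v + d)):]"
    by (simp add: v' power_add mult_ac flip: power_mult)
  finally have div: "(\<Prod>k\<in>{k\<in>{1..l ^ v}. l dvd k}. f k) = Y ^ (l ^ (v + d)) - [:b ^ (l ^ (v + d)):]" .
  have "(\<Prod>k\<in>{1..l ^ v}. f k) = (\<Prod>k\<in>{k\<in>{1..l ^ v}. l dvd k} \<union> {k\<in>{1..l ^ v}. \<not> l dvd k}. f k)"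
    by (rule prod.cong) auto
  also have "\<dots> = (\<Prod>k\<in>{k\<in>{1..l ^ v}. l dvd k}. f k) * (\<Prod>k\<in>{k\<in>{1..l ^ v}. \<not> l dvd k}. f k)"
    by (rule prod.union_disjoint) auto
  finally have split: "(\<Prod>k\<in>{1..l ^ v}. f k) =
      (Y ^ (l ^ (v + d)) - [:b ^ (l ^ (v + d)):]) * (\<Prod>k\<in>{k\<in>{1..l ^ v}. \<not> l dvd k}. f k)"
    by (simp only: div)
  have "(\<Prod>k\<in>{1..l ^ v}. f k) = (Y ^ (l ^ Suc d)) ^ (l ^ v) - [:(b ^ (l ^ Suc d)) ^ (l ^ v):]"
    unfolding f_def using l0 w by (intro prod_roots_of_unity_shifted) auto
  also have "\<dots> = Y ^ (l ^ (v + Suc d)) - [:b ^ (l ^ (v + Suc d)):]"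
    by (simp add: power_add mult_ac flip: power_mult)
  finally show ?case
    using split Suc.IH by (simp add: f_def mult.assoc[symmetric])
qed

section \<open>Exponents with respect to a generator of the multiplicative group\<close>

locale field_generator =
  fixes \<xi> :: "'a::{finite,field}" and q :: nat
  assumes generator_nonzero: "\<xi> \<noteq> 0"
    and generates: "\<And>x. x \<noteq> 0 \<Longrightarrow> \<exists>k::nat. x = \<xi> ^ k"
    and card_field: "card (UNIV :: 'a set) = q"
begin

lemma card_gt_1: "1 < q"
proof -
  have "card {0, 1 :: 'a} \<le> card (UNIV :: 'a set)" by (rule card_mono) auto
  then show ?thesis by (simp add: card_field)
qed

lemma generator_power_card: "\<xi> ^ (q - 1) = 1"
proof -
  have "(\<Prod>x\<in>UNIV - {0}. x) = (\<Prod>x\<in>UNIV - {0}. \<xi> * x)"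
    by (rule prod.reindex_bij_witness[of _ "\<lambda>x. \<xi> * x" "\<lambda>x. inverse \<xi> * x"])
      (use generator_nonzero in \<open>auto simp: field_simps\<close>)
  also have "\<dots> = \<xi> ^ (q - 1) * (\<Prod>x\<in>UNIV - {0}. x)"
    by (simp add: prod.distrib card_Diff_singleton card_field)
  finally show ?thesis by simp
qed

lemma generator_power_eq_1_iff: "\<xi> ^ k = 1 \<longleftrightarrow> q - 1 dvd k"
proof
  assume "q - 1 dvd k"
  then show "\<xi> ^ k = 1"
    using generator_power_card by (auto simp: power_mult)
next
  assume k: "\<xi> ^ k = 1"
  define r where "r = k mod (q - 1)"
  have "\<xi> ^ k = \<xi> ^ r * (\<xi> ^ (q - 1)) ^ (k div (q - 1))"
    by (simp add: r_def flip: power_add power_mult)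
  then have r1: "\<xi> ^ r = 1" unfolding generator_power_card using k by simp
  \<comment> \<open>If xi^r = 1 with 0 < r < q - 1, the powers of xi take at most r values, too few
    for the q - 1 nonzero elements.\<close>
  have "r = 0"
  proof (rule ccontr)
    assume "r \<noteq> 0"
    have "UNIV - {0} \<subseteq> (\<lambda>i. \<xi> ^ i) ` {..<r}"
    proof
      fix x :: 'a assume "x \<in> UNIV - {0}"
      then obtain i where i: "x = \<xi> ^ i" using generates by blast
      have "\<xi> ^ i = \<xi> ^ (i mod r) * (\<xi> ^ r) ^ (i div r)"
        by (simp flip: power_add power_mult)
      then show "x \<in> (\<lambda>i. \<xi> ^ i) ` {..<r}" using i r1 \<open>r \<noteq> 0\<close> by auto
    qed
    then have "card (UNIV - {0 :: 'a}) \<le> card ((\<lambda>i. \<xi> ^ i) ` {..<r})"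
      by (intro card_mono) auto
    also have "\<dots> \<le> r" using card_image_le[of "{..<r}" "\<lambda>i. \<xi> ^ i"] by simp
    finally have "q - 1 \<le> r" by (simp add: card_Diff_singleton card_field)
    moreover have "r < q - 1" using card_gt_1 by (simp add: r_def)
    ultimately show False by simp
  qed
  then show "q - 1 dvd k" by (simp add: r_def mod_eq_0_iff_dvd)
qed

lemma generator_power_cong:
  assumes "[i = j] (mod (q - 1))"
  shows "\<xi> ^ i = \<xi> ^ j"
proof -
  have mod: "\<xi> ^ k = \<xi> ^ (k mod (q - 1))" for k
  proof -
    have "\<xi> ^ k = \<xi> ^ (k mod (q - 1)) * (\<xi> ^ (q - 1)) ^ (k div (q - 1))"
      by (simp flip: power_add power_mult)
    then show ?thesis unfolding generator_power_card by simp
  qed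
  have "\<xi> ^ i = \<xi> ^ (i mod (q - 1))" by (rule mod)
  also have "\<dots> = \<xi> ^ (j mod (q - 1))" using assms by (simp only: cong_def)
  also have "\<dots> = \<xi> ^ j" by (rule mod [symmetric])
  finally show ?thesis .
qed

lemma primitive_root_of_unity:
  assumes "t dvd q - 1"
  shows "(\<xi> ^ ((q - 1) div t)) ^ k = 1 \<longleftrightarrow> t dvd k"
proof -
  obtain w where w: "q - 1 = t * w" using assms by auto
  then have "0 < t" "0 < w" using card_gt_1 by (auto intro!: gr0I)
  then have "(q - 1) div t = w" unfolding w by simp
  then show ?thesis
    using \<open>0 < w\<close> unfolding generator_power_eq_1_iff power_mult [symmetric] w
    by (simp add: mult.commute)
qed

text \<open>In exponents, an N-th root is a solution of the linear congruence N x = e modulo q -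
  1.\<close>

lemma ex_root:
  assumes "gcd N (q - 1) dvd e"
  shows "\<exists>x. (\<xi> ^ x) ^ N = \<xi> ^ e"
proof -
  obtain x where "[N * x = e] (mod (q - 1))"
    using cong_solve_dvd_nat assms by blast
  then show ?thesis
    using generator_power_cong[of "N * x" e] by (auto simp: mult.commute simp flip: power_mult)
qed

text \<open>With c = xi^x the constant term has exponent x t + e, congruent to e modulo every prime
  r dividing t. Whether it is an r-th power thus depends on e alone, and the scaling c drops out of
  all later irreducibility arguments.\<close>

lemma irreducible_binomial_generator:
  assumes t: "0 < t" and c: "c \<noteq> 0"
    and pr: "\<And>r. prime r \<Longrightarrow> r dvd t \<Longrightarrow> r dvd q - 1 \<and> \<not> r dvd e"
    and four: "4 dvd t \<Longrightarrow> 4 dvd q - 1"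
  shows "irreducible (monom 1 t - [:c ^ t * \<xi> ^ e:])"
proof -
  obtain x where x: "c = \<xi> ^ x" using generates c by blast
  have a: "c ^ t * \<xi> ^ e = \<xi> ^ (x * t + e)" by (simp add: x power_add power_mult)
  have "irreducible (monom 1 t - [:\<xi> ^ (x * t + e):])"
  proof (rule irreducible_binomial)
    show "(\<xi> ^ (x * t + e)) ^ (card (UNIV :: 'a set) - 1) = 1"
      by (simp add: card_field generator_power_eq_1_iff flip: power_mult)
    fix r :: nat assume r: "prime r" "r dvd t"
    then have rq: "r dvd q - 1" and e: "\<not> r dvd e" using pr by auto
    obtain w where w: "q - 1 = r * w" using rq by auto
    then have "0 < r" "0 < w" using card_gt_1 by (auto intro!: gr0I)
    moreover have "\<not> r dvd x * t + e" using r e by (simp add: dvd_add_right_iff)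
    ultimately have "(\<xi> ^ (x * t + e)) ^ ((q - 1) div r) \<noteq> 1"
      unfolding power_mult [symmetric] generator_power_eq_1_iff w by simp
    then show "r dvd card (UNIV :: 'a set) - 1 \<and> (\<xi> ^ (x * t + e)) ^ ((card (UNIV :: 'a set) - 1) div r) \<noteq> 1"
      using rq by (simp add: card_field)
  qed (use t four generator_nonzero in \<open>simp_all add: card_field\<close>)
  then show ?thesis by (simp add: a)
qed

end

section \<open>Characteristic and Frobenius\<close>

lemma CHAR_eq_prime:
  assumes "prime p" "card (UNIV :: 'a::{finite,field} set) = p ^ s"
  shows "CHAR('a) = p"
proof -
  \<comment> \<open>Translation by 1 permutes the field, so the two sums agree and their difference,
    the field size times 1, vanishes.\<close>
  have "(\<Sum>x\<in>(UNIV :: 'a set). x) = (\<Sum>x\<in>(UNIV :: 'a set). x + 1)"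
    by (rule sum.reindex_bij_witness[of _ "\<lambda>x. x + 1" "\<lambda>x. x - 1"]) auto
  then have "of_nat (p ^ s) = (0 :: 'a)"
    by (simp add: sum.distrib assms(2) del: of_nat_power)
  then have dvd: "CHAR('a) dvd p ^ s" by (simp only: of_nat_eq_0_iff_char_dvd)
  have "0 < CHAR('a)" by (rule finite_imp_CHAR_pos) simp
  then have "prime CHAR('a)" by (rule prime_CHAR_semidom)
  then show ?thesis
    using dvd assms(1) by (metis prime_dvd_power primes_dvd_imp_eq)
qed

text \<open>The power map is applied to the sum (X^k - a) + a, so no sign (-1)^(p^n) has to be
  discussed.\<close>

lemma binomial_power_CHAR:
  fixes a :: "'a::field"
  assumes "prime CHAR('a)"
  shows "(monom 1 k - [:a:]) ^ (CHAR('a) ^ n) = monom 1 (k * CHAR('a) ^ n) - [:a ^ (CHAR('a) ^ n):]"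
proof -
  define K where "K = CHAR('a) ^ n"
  have "((monom 1 k - [:a:]) + [:a:]) ^ K = (monom 1 k - [:a:]) ^ K + [:a:] ^ K"
    by (rule freshmans_dream'[where n = n]) (use assms in \<open>simp_all add: K_def\<close>)
  then show ?thesis
    by (simp add: K_def monom_power poly_const_pow algebra_simps)
qed

section \<open>Factorization of the modulus\<close>

lemma diff_uminus_const_poly: "P - [:- a:] = P + [:a :: 'a::ab_group_add:]"
  by (rule poly_eqI) (simp add: coeff_pCons split: nat.split)

locale constacyclic_setting = field_generator \<xi> q
  for \<xi> :: "'a::{finite,field}" and q :: nat +
  fixes p s l m n u :: nat and lam :: 'a and C :: "'a list set"
  assumes prime_p: "prime p" and odd_p: "odd p" and q_eq: "q = p ^ s"
    and prime_l: "prime l" and odd_l: "odd l" and l_dvd: "l dvd q - 1"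
    and m_pos: "0 < m"
    and u_dvd: "l ^ u dvd q - 1" and u_max: "\<not> l ^ (u + 1) dvd q - 1"
    and lam_nonzero: "lam \<noteq> 0"
    and code: "constacyclic_code lam (2 * l ^ m * p ^ n) C"
begin

abbreviation "N \<equiv> 2 * l ^ m * p ^ n"
abbreviation "v \<equiv> min m u"
abbreviation "\<zeta> \<equiv> \<xi> ^ ((q - 1) div l ^ v)"

section \<open>Arithmetic of q - 1, N-th powers and cosets\<close>

lemma l_pos: "0 < l"
  using prime_l by (rule prime_gt_0_nat)

lemma v_pos: "0 < v"
  using u_max l_dvd m_pos by (cases u) auto

lemma N_pos: "0 < N"
  using l_pos prime_gt_0_nat[OF prime_p] by simp

lemma l_power_dvd: "k \<le> u \<Longrightarrow> l ^ k dvd q - 1"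
  using u_dvd le_imp_power_dvd dvd_trans by blast

lemma two_dvd: "2 dvd q - 1"
  using odd_p by (simp add: q_eq)

lemma two_l_power_dvd: "2 * l ^ v dvd q - 1"
  using two_dvd l_power_dvd[of v] odd_l by (intro divides_mult) auto

text \<open>Roots of unity of l-power order are therefore squares, and multiplying by them preserves
  the parity of an exponent of xi.\<close>

lemma even_cofactor: "k \<le> u \<Longrightarrow> even ((q - 1) div l ^ k)"
  using two_dvd l_power_dvd[of k] odd_l
  by (metis dvd_div_mult_self even_mult_iff even_power)

text \<open>A primitive l^k-th root of unity is an l-th power for k < u but not for k = u, which is
  the next lemma. The first fact keeps case III from splitting further, the second makes the upper
  layers of cases I and II irreducible.\<close>

lemma l_dvd_cofactor: "k < u \<Longrightarrow> l dvd (q - 1) div l ^ k"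
  using l_power_dvd[of "Suc k"] l_power_dvd[of k] l_pos by (simp add: dvd_div_iff_mult mult.commute)

lemma l_not_dvd_cofactor: "\<not> l dvd (q - 1) div l ^ u"
  using u_max u_dvd l_pos by (simp add: dvd_div_iff_mult mult.commute)

lemma coprime_p: "coprime p (q - 1)"
proof (rule prime_imp_coprime[OF prime_p])
  have "s \<noteq> 0" using card_gt_1 q_eq by (cases s) auto
  then have "p dvd q" by (simp add: q_eq)
  show "\<not> p dvd q - 1"
  proof
    assume "p dvd q - 1"
    with \<open>p dvd q\<close> have "p dvd q - (q - 1)" by (rule dvd_diff_nat)
    then show False using card_gt_1 prime_gt_1_nat[OF prime_p] by simp
  qed
qed

text \<open>A common divisor is prime to p, because q - 1 is, and its l-part is bounded both by l^m
  and by l^u.\<close>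

lemma gcd_N_dvd: "gcd N (q - 1) dvd 2 * l ^ v"
proof -
  define d where "d = gcd N (q - 1)"
  have d: "d dvd q - 1" "d dvd 2 * l ^ m * p ^ n" by (simp_all add: d_def)
  have "coprime d (p ^ n)"
    using coprime_p d(1) by (metis coprime_commute coprime_divisors coprime_power_right_iff dvd_refl)
  then have "d dvd 2 * l ^ m" using d(2) by (simp add: coprime_dvd_mult_left_iff)
  then obtain a b where ab: "d = a * b" "a dvd 2" "b dvd l ^ m" using division_decomp by blast
  then obtain i where i: "i \<le> m" "b = l ^ i" using divides_primepow_nat[OF prime_l] by blast
  have "l ^ i dvd q - 1" using ab i d(1) dvd_mult_right by blast
  then have "i \<le> u"
    using u_max le_imp_power_dvd[of "u + 1" i l] dvd_trans by (metis not_less_eq_eq Suc_eq_plus1)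
  then have "b dvd l ^ v" using i by (simp add: le_imp_power_dvd)
  then show ?thesis using ab d_def by (metis mult_dvd_mono)
qed

text \<open>The quotient of lam by xi^e is an N-th power, since gcd(N, q - 1) divides 2 l^v; c is
  the inverse of an N-th root of it.\<close>

lemma ex_scaling:
  assumes "lam \<in> coset (\<xi> ^ e) (\<xi> ^ (2 * l ^ v))"
  shows "\<exists>c. c \<noteq> 0 \<and> c ^ N * lam = \<xi> ^ e"
proof -
  obtain i where i: "lam = \<xi> ^ e * \<xi> ^ (2 * l ^ v * i)"
    using assms by (auto simp: coset_def cyc_def simp flip: power_mult)
  obtain x where "(\<xi> ^ x) ^ N = \<xi> ^ (2 * l ^ v * i)"
    using ex_root[of N "2 * l ^ v * i"] gcd_N_dvd by (meson dvd_mult2)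
  then show ?thesis
    unfolding i using generator_nonzero by (intro exI[of _ "inverse (\<xi> ^ x)"]) (simp add: power_inverse)
qed

text \<open>Since p^n is invertible modulo 2 l^v, the exponent k of lam has the form j p^n modulo 2
  l^v. The factor p^n is what later allows a p^n-th root of lam to be written down.\<close>

lemma ex_coset:
  "\<exists>j < 2 * l ^ v. lam \<in> coset (\<xi> ^ (j * p ^ n)) (\<xi> ^ (2 * l ^ v))"
proof -
  obtain k where k: "lam = \<xi> ^ k" using generates lam_nonzero by blast
  have "coprime (p ^ n) (2 * l ^ v)"
    using coprime_p two_l_power_dvd by (metis coprime_divisors coprime_power_left_iff dvd_refl)
  then obtain x where x: "[p ^ n * x = 1] (mod 2 * l ^ v)"
    using cong_solve_coprime_nat by fastforce
  define j where "j = (x * k) mod (2 * l ^ v)"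
  have "[j * p ^ n = x * k * p ^ n] (mod 2 * l ^ v)"
    by (intro cong_mult cong_refl) (simp add: j_def)
  also have "x * k * p ^ n = (p ^ n * x) * k" by (simp add: mult_ac)
  also have "[(p ^ n * x) * k = 1 * k] (mod 2 * l ^ v)" using x by (intro cong_mult cong_refl)
  \<comment> \<open>The added multiple of q - 1 leaves the power of xi unchanged and makes the
    difference with j p^n a natural number.\<close>
  also have "[1 * k = k + (q - 1) * (j * p ^ n)] (mod 2 * l ^ v)"
  proof -
    obtain w where w: "q - 1 = 2 * l ^ v * w" using two_l_power_dvd by (rule dvdE)
    show ?thesis unfolding w mult.assoc[of "2 * l ^ v"] by (simp only: cong_def mod_mult_self2 mult_1)
  qed
  finally have "[k + (q - 1) * (j * p ^ n) = j * p ^ n] (mod 2 * l ^ v)" by (rule cong_sym)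
  moreover have le: "j * p ^ n \<le> k + (q - 1) * (j * p ^ n)"
  proof -
    have "1 * (j * p ^ n) \<le> (q - 1) * (j * p ^ n)" using card_gt_1 by (intro mult_le_mono1) simp
    then show ?thesis by linarith
  qed
  ultimately have "2 * l ^ v dvd (k + (q - 1) * (j * p ^ n)) - j * p ^ n"
    by (simp only: cong_altdef_nat)
  then obtain i where "(k + (q - 1) * (j * p ^ n)) - j * p ^ n = 2 * l ^ v * i" by (rule dvdE)
  then have i: "k + (q - 1) * (j * p ^ n) = j * p ^ n + 2 * l ^ v * i" using le by linarith
  have "lam = \<xi> ^ (k + (q - 1) * (j * p ^ n))"
    unfolding k power_add power_mult[of \<xi> "q - 1"] generator_power_card by simp
  also have "\<dots> = \<xi> ^ (j * p ^ n) * (\<xi> ^ (2 * l ^ v)) ^ i"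
    unfolding i power_add power_mult[of \<xi> "2 * l ^ v"] ..
  finally have "lam \<in> coset (\<xi> ^ (j * p ^ n)) (\<xi> ^ (2 * l ^ v))"
    unfolding coset_def cyc_def by blast
  moreover have "j < 2 * l ^ v" using l_pos by (simp add: j_def)
  ultimately show ?thesis by blast
qed

lemma modulus_eq_power:
  assumes "c \<noteq> 0" "c ^ N * lam = \<xi> ^ (j * p ^ n)"
  shows "monom 1 N - [:lam:] = (monom 1 (2 * l ^ m) - [:inverse c ^ (2 * l ^ m) * \<xi> ^ j:]) ^ (p ^ n)"
proof -
  have char: "CHAR('a) = p"
    using CHAR_eq_prime[OF prime_p] card_field q_eq by blast
  have "lam = inverse c ^ N * (c ^ N * lam)"
    using assms(1) by (simp add: power_inverse)
  also have "\<dots> = (inverse c ^ (2 * l ^ m) * \<xi> ^ j) ^ (p ^ n)"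
    unfolding assms(2) by (simp add: power_mult_distrib power_mult)
  finally have lam: "lam = (inverse c ^ (2 * l ^ m) * \<xi> ^ j) ^ (p ^ n)" .
  show ?thesis
    by (subst lam) (use binomial_power_CHAR[where 'a = 'a, unfolded char, OF prime_p] in simp)
qed

section \<open>Irreducible binomials of degree l^j and 2 l^j\<close>

lemma irreducible_l_power:
  assumes "c \<noteq> 0" "0 < j \<Longrightarrow> \<not> l dvd e"
  shows "irreducible (monom 1 (l ^ j) - [:c ^ (l ^ j) * \<xi> ^ e:])"
proof (rule irreducible_binomial_generator)
  fix r :: nat assume r: "prime r" "r dvd l ^ j"
  then have "r = l" using prime_dvd_power primes_dvd_imp_eq prime_l by metis
  moreover have "0 < j" using r by (cases j) auto
  ultimately show "r dvd q - 1 \<and> \<not> r dvd e" using assms l_dvd by simp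
next
  assume "4 dvd l ^ j"
  then have "even (l ^ j)" by (rule dvd_trans[rotated]) simp
  then show "4 dvd q - 1" using odd_l by simp
qed (use assms l_pos in simp_all)

text \<open>The exponent l^j is odd, so replacing c by -c changes the sign of the constant
  term.\<close>

lemma irreducible_l_power_plus:
  assumes "c \<noteq> 0" "0 < j \<Longrightarrow> \<not> l dvd e"
  shows "irreducible (monom 1 (l ^ j) + [:c ^ (l ^ j) * \<xi> ^ e:])"
  using irreducible_l_power[of "- c" j e] assms odd_l by (simp add: diff_uminus_const_poly)

text \<open>Oddness of e handles the prime 2. As l is odd, 4 does not divide 2 l^j and the condition
  modulo 4 is vacuous.\<close>

lemma irreducible_two_l_power:
  assumes "c \<noteq> 0" "odd e" "0 < j \<Longrightarrow> \<not> l dvd e"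
  shows "irreducible (monom 1 (2 * l ^ j) - [:c ^ (2 * l ^ j) * \<xi> ^ e:])"
proof (rule irreducible_binomial_generator)
  fix r :: nat assume r: "prime r" "r dvd 2 * l ^ j"
  show "r dvd q - 1 \<and> \<not> r dvd e"
  proof (cases "r = 2")
    case True
    then show ?thesis using two_dvd assms by simp
  next
    case False
    then have "\<not> r dvd 2" using r primes_dvd_imp_eq two_is_prime_nat by blast
    then have "r dvd l ^ j" using r by (simp add: prime_dvd_mult_iff)
    then have "r = l" using r prime_dvd_power primes_dvd_imp_eq prime_l by metis
    moreover have "0 < j" using r \<open>r dvd l ^ j\<close> by (cases j) auto
    ultimately show ?thesis using assms l_dvd by simp
  qed
next
  assume "4 dvd 2 * l ^ j"
  then have "2 * 2 dvd 2 * l ^ j" by simp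
  then have "even (l ^ j)" unfolding dvd_mult_cancel_left by simp
  then show "4 dvd q - 1" using odd_l by simp
qed (use assms l_pos in simp_all)

section \<open>Generator polynomials case by case\<close>

lemma code_generator: "\<exists>g. g dvd monom 1 N - [:lam:] \<and> C = gen_code lam N g"
  by (rule constacyclic_code_generator[OF code N_pos])

lemma zeta_power_eq_1_iff: "\<zeta> ^ k = 1 \<longleftrightarrow> l ^ v dvd k"
  by (intro primitive_root_of_unity l_power_dvd) simp

lemma l_not_dvd_zeta_exponent:
  assumes "u < m" "\<not> l dvd k"
  shows "\<not> l dvd (q - 1) div l ^ v * k"
  using assms l_not_dvd_cofactor prime_l by (simp add: min_def prime_dvd_mult_iff)

lemma v_add_diff: "v + (m - u) = m"
  by simp

text \<open>Here j = 0 and the inner binomial is a difference of squares. The factor with the plus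
  sign is split like the other one, with -b in place of b, because l is odd.\<close>

lemma case_I:
  assumes c: "c \<noteq> 0" "c ^ N * lam = 1"
  shows "\<exists>\<epsilon>1 \<epsilon>2 \<tau> \<sigma>.
    (\<forall>i::nat. \<epsilon>1 i \<le> p ^ n \<and> \<epsilon>2 i \<le> p ^ n) \<and>
    (\<forall>(j::nat) (k::nat). \<tau> j k \<le> p ^ n \<and> \<sigma> j k \<le> p ^ n) \<and>
    C = gen_code lam N
      ((\<Prod>i<l ^ v. [:- (inverse c * \<zeta> ^ i), 1:] ^ \<epsilon>1 i * [:inverse c * \<zeta> ^ i, 1:] ^ \<epsilon>2 i) *
       (\<Prod>j\<in>{1..m - u}. \<Prod>k\<in>{k\<in>{1..l ^ v}. \<not> l dvd k}.
          (monom 1 (l ^ j) - [:inverse c ^ (l ^ j) * \<zeta> ^ k:]) ^ \<tau> j k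
          * (monom 1 (l ^ j) + [:inverse c ^ (l ^ j) * \<zeta> ^ k:]) ^ \<sigma> j k))"
proof -
  define b where "b = inverse c"
  have b0: "b \<noteq> 0" using c by (simp add: b_def)
  \<comment> \<open>For m \<le> u the truncated difference is 0 and \<open>J\<close> is empty: only
    the linear factors remain.\<close>
  define J where "J = {1..m - u}"
  define R where "R = {k\<in>{1..l ^ v}. \<not> l dvd k}"
  define A1 where "A1 i = [:- (b * \<zeta> ^ i), 1:]" for i
  define A2 where "A2 i = [:b * \<zeta> ^ i, 1:]" for i
  define B1 where "B1 j k = monom 1 (l ^ j) - [:b ^ (l ^ j) * \<zeta> ^ k:]" for j k
  define B2 where "B2 j k = monom 1 (l ^ j) + [:b ^ (l ^ j) * \<zeta> ^ k:]" for j k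
  note factor = prod_roots_of_unity_prime_power[OF prime_l v_pos zeta_power_eq_1_iff,
      where Y = "monom 1 1" and d = "m - u", folded J_def R_def, unfolded v_add_diff monom_power power_one mult_1]
  have 1: "(\<Prod>i<l ^ v. A1 i) * (\<Prod>j\<in>J. \<Prod>k\<in>R. B1 j k) = monom 1 (l ^ m) - [:b ^ (l ^ m):]"
    using factor[of b] by (simp add: A1_def B1_def monom_altdef)
  have 2: "(\<Prod>i<l ^ v. A2 i) * (\<Prod>j\<in>J. \<Prod>k\<in>R. B2 j k) = monom 1 (l ^ m) + [:b ^ (l ^ m):]"
    using factor[of "- b"] odd_l by (simp add: A2_def B2_def monom_altdef diff_uminus_const_poly)
  have "monom 1 (2 * l ^ m) - [:b ^ (2 * l ^ m):]
      = (monom 1 (l ^ m) - [:b ^ (l ^ m):]) * (monom 1 (l ^ m) + [:b ^ (l ^ m):])"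
    by (simp add: algebra_simps mult_monom mult_2 power_add)
  \<comment> \<open>Nested to the right and ended by 1, so that the four families can be peeled off
    in order and the last cofactor divides 1, that is, is a unit.\<close>
  then have M: "monom 1 N - [:lam:] = (\<Prod>i<l ^ v. A1 i ^ p ^ n) * ((\<Prod>i<l ^ v. A2 i ^ p ^ n) *
      ((\<Prod>j\<in>J. \<Prod>k\<in>R. B1 j k ^ p ^ n) * ((\<Prod>j\<in>J. \<Prod>k\<in>R. B2 j k ^ p ^ n) * 1)))"
    using modulus_eq_power[of c 0] c
    by (simp add: 1[symmetric] 2[symmetric] flip: b_def)
      (simp add: prod_power_distrib power_mult_distrib mult_ac)
  have irrA: "irreducible (A1 i)" "irreducible (A2 i)" for i
    by (simp_all add: A1_def A2_def irreducible_linear_field_poly)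
  \<comment> \<open>A member of \<open>J\<close> forces u < m, hence v = u, and then (q - 1) / l^v
    is prime to l.\<close>
  have irrB: "irreducible (B1 j k)" "irreducible (B2 j k)" if "j \<in> J" "k \<in> R" for j k
  proof -
    have "\<not> l dvd (q - 1) div l ^ v * k"
      using that by (intro l_not_dvd_zeta_exponent) (auto simp: J_def R_def)
    then show "irreducible (B1 j k)" "irreducible (B2 j k)"
      unfolding B1_def B2_def power_mult [symmetric, of \<xi>]
      by (intro irreducible_l_power irreducible_l_power_plus b0; assumption)+
  qed
  have fin: "finite J" "finite R" by (simp_all add: J_def R_def)
  obtain g where g: "g dvd monom 1 N - [:lam:]" "C = gen_code lam N g"
    using code_generator by blast
  obtain \<epsilon>1 g1 where g1: "\<forall>i. \<epsilon>1 i \<le> p ^ n" "g = (\<Prod>i<l ^ v. A1 i ^ \<epsilon>1 i) * g1"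
      "g1 dvd (\<Prod>i<l ^ v. A2 i ^ p ^ n) * ((\<Prod>j\<in>J. \<Prod>k\<in>R. B1 j k ^ p ^ n) * ((\<Prod>j\<in>J. \<Prod>k\<in>R. B2 j k ^ p ^ n) * 1))"
    using dvd_prod_irreducible_power_mult[OF finite_lessThan irrA(1) g(1)[unfolded M]] by blast
  obtain \<epsilon>2 g2 where g2: "\<forall>i. \<epsilon>2 i \<le> p ^ n" "g1 = (\<Prod>i<l ^ v. A2 i ^ \<epsilon>2 i) * g2"
      "g2 dvd (\<Prod>j\<in>J. \<Prod>k\<in>R. B1 j k ^ p ^ n) * ((\<Prod>j\<in>J. \<Prod>k\<in>R. B2 j k ^ p ^ n) * 1)"
    using dvd_prod_irreducible_power_mult[OF finite_lessThan irrA(2) g1(3)] by blast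
  obtain \<tau> g3 where g3: "\<forall>j k. \<tau> j k \<le> p ^ n" "g2 = (\<Prod>j\<in>J. \<Prod>k\<in>R. B1 j k ^ \<tau> j k) * g3"
      "g3 dvd (\<Prod>j\<in>J. \<Prod>k\<in>R. B2 j k ^ p ^ n) * 1"
    using dvd_prod_prod_irreducible_power_mult[OF fin irrB(1) g2(3)] by blast
  obtain \<sigma> g4 where g4: "\<forall>j k. \<sigma> j k \<le> p ^ n" "g3 = (\<Prod>j\<in>J. \<Prod>k\<in>R. B2 j k ^ \<sigma> j k) * g4" "is_unit g4"
    using dvd_prod_prod_irreducible_power_mult[OF fin irrB(2) g3(3)] by blast
  have eq: "g = ((\<Prod>i<l ^ v. A1 i ^ \<epsilon>1 i * A2 i ^ \<epsilon>2 i) * (\<Prod>j\<in>J. \<Prod>k\<in>R. B1 j k ^ \<tau> j k * B2 j k ^ \<sigma> j k)) * g4"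
    unfolding g1(2) g2(2) g3(2) g4(2) by (simp add: prod.distrib mult_ac)
  have "C = gen_code lam N ((\<Prod>i<l ^ v. A1 i ^ \<epsilon>1 i * A2 i ^ \<epsilon>2 i) * (\<Prod>j\<in>J. \<Prod>k\<in>R. B1 j k ^ \<tau> j k * B2 j k ^ \<sigma> j k))"
    unfolding g(2) eq gen_code_mult_unit[OF g4(3)] ..
  then show ?thesis
    using g1(1) g2(1) g3(1) g4(1)
    unfolding A1_def A2_def B1_def B2_def J_def R_def b_def
    by (intro exI[of _ \<epsilon>1] exI[of _ \<epsilon>2] exI[of _ \<tau>] exI[of _ \<sigma>]) blast
qed

lemma code_eq_prod:
  assumes "finite A" "\<And>i. i \<in> A \<Longrightarrow> irreducible (f i)" "monom 1 N - [:lam:] = (\<Prod>i\<in>A. f i) ^ (p ^ n)"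
  shows "\<exists>\<epsilon>. (\<forall>i. \<epsilon> i \<le> p ^ n) \<and> C = gen_code lam N (\<Prod>i\<in>A. f i ^ \<epsilon> i)"
proof -
  obtain g where g: "g dvd monom 1 N - [:lam:]" "C = gen_code lam N g"
    using code_generator by blast
  have "g dvd (\<Prod>i\<in>A. f i ^ p ^ n) * 1"
    using g(1) unfolding assms(3) by (simp add: prod_power_distrib)
  from dvd_prod_irreducible_power_mult[OF assms(1,2) this]
  obtain \<epsilon> g' where \<epsilon>: "\<forall>i. \<epsilon> i \<le> p ^ n" "g = (\<Prod>i\<in>A. f i ^ \<epsilon> i) * g'" "is_unit g'"
    by blast
  have "C = gen_code lam N (\<Prod>i\<in>A. f i ^ \<epsilon> i)"
    unfolding g(2) \<epsilon>(2) gen_code_mult_unit[OF \<epsilon>(3)] ..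
  with \<epsilon>(1) show ?thesis by blast
qed

text \<open>Now v = m, so the constant term of the inner binomial is the l^m-th power of c^(-2) xi
  and the l^m-th roots of unity split it into quadratics. Their constants carry an odd exponent of
  xi and are nonsquares.\<close>

lemma case_II_A:
  assumes c: "c \<noteq> 0" "c ^ N * lam = \<xi> ^ (l ^ v * p ^ n)" and mu: "m \<le> u"
  shows "\<exists>\<epsilon>. (\<forall>i. \<epsilon> i \<le> p ^ n) \<and> C = gen_code lam N
    (\<Prod>i<l ^ m. (monom 1 2 - [:inverse c ^ 2 * \<xi> * (\<xi> ^ ((q - 1) div l ^ m)) ^ i:]) ^ \<epsilon> i)"
proof (rule code_eq_prod)
  have v: "v = m" using mu by simp
  show "irreducible (monom 1 2 - [:inverse c ^ 2 * \<xi> * (\<xi> ^ ((q - 1) div l ^ m)) ^ i:])" for i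
    using irreducible_two_l_power[of "inverse c" "1 + (q - 1) div l ^ m * i" 0] c even_cofactor[OF mu]
    by (simp add: power_add mult.assoc flip: power_mult)
  have "(\<Prod>i<l ^ m. monom 1 2 - [:(inverse c ^ 2 * \<xi>) * (\<xi> ^ ((q - 1) div l ^ m)) ^ i:])
      = monom 1 2 ^ (l ^ m) - [:(inverse c ^ 2 * \<xi>) ^ (l ^ m):]"
    using l_pos by (intro prod_roots_of_unity primitive_root_of_unity l_power_dvd mu) simp
  also have "\<dots> = monom 1 (2 * l ^ m) - [:inverse c ^ (2 * l ^ m) * \<xi> ^ (l ^ m):]"
    by (simp add: monom_power power_mult_distrib power_mult)
  finally show "monom 1 N - [:lam:]
      = (\<Prod>i<l ^ m. monom 1 2 - [:inverse c ^ 2 * \<xi> * (\<xi> ^ ((q - 1) div l ^ m)) ^ i:]) ^ (p ^ n)"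
    using modulus_eq_power[OF c(1), of "l ^ v"] c(2) unfolding v by simp
qed simp

text \<open>Since q - 1 is even, raising to the power (q - 1) / 2 detects the parity of an exponent
  of xi.\<close>

lemma generator_power_parity:
  assumes "\<xi> ^ a = \<xi> ^ b"
  shows "even a \<longleftrightarrow> even b"
proof -
  have "(\<xi> ^ ((q - 1) div 2)) ^ a = (\<xi> ^ ((q - 1) div 2)) ^ b"
    using assms by (metis power_commuting_commutes power_mult mult.commute)
  then show ?thesis
    using primitive_root_of_unity[OF two_dvd, of a] primitive_root_of_unity[OF two_dvd, of b] by simp
qed

text \<open>For beta = xi^(l^u x) the equation reads l^(u+m) x = -l^u modulo q - 1. It is solvable
  because the l-part of q - 1 is only l^u.\<close>

lemma ex_beta: "\<exists>\<beta>. \<beta> \<in> cyc (\<xi> ^ (l ^ u)) \<and> \<beta> ^ (l ^ m) * \<xi> ^ (l ^ u) = 1"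
proof -
  have "gcd (l ^ (u + m)) (q - 1) dvd l ^ (u + m)" by simp
  then obtain i where i: "gcd (l ^ (u + m)) (q - 1) = l ^ i"
    using divides_primepow_nat[OF prime_l] by blast
  then have "l ^ i dvd q - 1" by (metis gcd_dvd2)
  then have "i \<le> u"
    using u_max le_imp_power_dvd[of "u + 1" i l] dvd_trans by (metis not_less_eq_eq Suc_eq_plus1)
  \<comment> \<open>The factor q - 2 stands for -1 modulo q - 1, keeping exponents natural.\<close>
  then have "gcd (l ^ (u + m)) (q - 1) dvd l ^ u * (q - 2)"
    unfolding i by (intro dvd_mult2 le_imp_power_dvd)
  then obtain x where x: "(\<xi> ^ x) ^ (l ^ (u + m)) = \<xi> ^ (l ^ u * (q - 2))"
    using ex_root by blast
  have "((\<xi> ^ (l ^ u)) ^ x) ^ (l ^ m) = (\<xi> ^ x) ^ (l ^ (u + m))"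
    by (simp add: power_add mult_ac flip: power_mult)
  then have "((\<xi> ^ (l ^ u)) ^ x) ^ (l ^ m) * \<xi> ^ (l ^ u) = \<xi> ^ (l ^ u * (q - 2) + l ^ u)"
    by (simp only: x power_add[of \<xi>])
  also have "l ^ u * (q - 2) + l ^ u = l ^ u * (q - 1)"
  proof -
    have "q - 1 = Suc (q - 2)" using card_gt_1 by simp
    then show ?thesis by simp
  qed
  also have "\<xi> ^ (l ^ u * (q - 1)) = 1" by (simp add: generator_power_eq_1_iff)
  finally show ?thesis unfolding cyc_def by blast
qed

text \<open>The inverse of beta is an l^m-th root of xi^(l^u), so the layered factorization applies
  with Y = X^2 and b = c^(-2) beta^(-1).\<close>

lemma case_II_B:
  assumes c: "c \<noteq> 0" "c ^ N * lam = \<xi> ^ (l ^ v * p ^ n)" and mu: "u < m"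
    and \<beta>: "\<beta> ^ (l ^ m) * \<xi> ^ (l ^ u) = 1"
  shows "\<exists>\<epsilon> \<sigma>. (\<forall>i::nat. \<epsilon> i \<le> p ^ n) \<and> (\<forall>(j::nat) (k::nat). \<sigma> j k \<le> p ^ n) \<and>
    C = gen_code lam N
      ((\<Prod>i<l ^ u. (monom 1 2 - [:inverse c ^ 2 * inverse \<beta> * \<zeta> ^ i:]) ^ \<epsilon> i) *
       (\<Prod>j\<in>{1..m - u}. \<Prod>k\<in>{k\<in>{1..l ^ u}. \<not> l dvd k}.
          (monom 1 (2 * l ^ j)
             - [:inverse c ^ (2 * l ^ j) * inverse \<beta> ^ (l ^ j) * \<zeta> ^ k:]) ^ \<sigma> j k))"
proof -
  have v: "v = u" using mu by simp
  define J where "J = {1..m - u}"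
  define R where "R = {k\<in>{1..l ^ u}. \<not> l dvd k}"
  define A where "A i = monom 1 2 - [:inverse c ^ 2 * inverse \<beta> * \<zeta> ^ i:]" for i
  define B where "B j k = monom 1 (2 * l ^ j) - [:inverse c ^ (2 * l ^ j) * inverse \<beta> ^ (l ^ j) * \<zeta> ^ k:]"
    for j k
  have \<beta>0: "\<beta> \<noteq> 0" using \<beta> l_pos by (auto simp: power_0_left)
  then have inv\<beta>: "inverse \<beta> ^ (l ^ m) = \<xi> ^ (l ^ u)"
    using \<beta> by (simp add: power_inverse field_simps)
  obtain y where y: "inverse \<beta> = \<xi> ^ y" using generates[of "inverse \<beta>"] \<beta>0 by auto
  \<comment> \<open>Comparing parities in xi^(y l^m) = xi^(l^u), where both powers of l are odd;
    hence the constants below are nonsquares.\<close>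
  have "odd y"
  proof -
    have "\<xi> ^ (y * l ^ m) = \<xi> ^ (l ^ u)" using inv\<beta> unfolding y by (simp add: power_mult)
    from generator_power_parity[OF this] show ?thesis using odd_l by simp
  qed
  have "(\<Prod>i<l ^ u. A i) * (\<Prod>j\<in>J. \<Prod>k\<in>R. B j k)
      = (\<Prod>i<l ^ u. monom 1 2 - [:(inverse c ^ 2 * inverse \<beta>) * \<zeta> ^ i:]) *
        (\<Prod>j\<in>J. \<Prod>k\<in>R. monom 1 2 ^ (l ^ j) - [:(inverse c ^ 2 * inverse \<beta>) ^ (l ^ j) * \<zeta> ^ k:])"
    by (simp add: A_def B_def monom_power power_mult_distrib power_mult)
  also have "\<dots> = monom 1 2 ^ (l ^ m) - [:(inverse c ^ 2 * inverse \<beta>) ^ (l ^ m):]"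
    using prod_roots_of_unity_prime_power[OF prime_l v_pos zeta_power_eq_1_iff,
      where Y = "monom 1 2" and d = "m - u" and b = "inverse c ^ 2 * inverse \<beta>", unfolded v_add_diff]
    unfolding J_def R_def v .
  also have "\<dots> = monom 1 (2 * l ^ m) - [:inverse c ^ (2 * l ^ m) * \<xi> ^ (l ^ u):]"
    by (simp add: monom_power power_mult_distrib power_mult inv\<beta>)
  finally have "monom 1 N - [:lam:] = ((\<Prod>i<l ^ u. A i) * (\<Prod>j\<in>J. \<Prod>k\<in>R. B j k)) ^ (p ^ n)"
    using modulus_eq_power[OF c] unfolding v by (simp only:)
  then have M: "monom 1 N - [:lam:] = (\<Prod>i<l ^ u. A i ^ p ^ n) * ((\<Prod>j\<in>J. \<Prod>k\<in>R. B j k ^ p ^ n) * 1)"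
    by (simp only: power_mult_distrib prod_power_distrib mult_1_right)
  have irrA: "irreducible (A i)" for i
    using irreducible_two_l_power[of "inverse c" "y + (q - 1) div l ^ v * i" 0] c even_cofactor[of v] \<open>odd y\<close>
    by (simp add: A_def y power_add mult.assoc flip: power_mult)
  have irrB: "irreducible (B j k)" if jk: "j \<in> J" "k \<in> R" for j k
  proof -
    have j: "0 < j" using jk by (simp add: J_def)
    have "\<not> l dvd (q - 1) div l ^ v * k"
      using jk mu by (intro l_not_dvd_zeta_exponent) (auto simp: R_def)
    \<comment> \<open>In the upper layers the contribution of beta is an l-th power, so zeta^k alone
      prevents the constant from being one.\<close>
    moreover have "l dvd y * l ^ j" using j by (simp add: dvd_mult dvd_power)
    ultimately have "\<not> l dvd y * l ^ j + (q - 1) div l ^ v * k"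
      by (simp add: dvd_add_right_iff)
    moreover have "odd (y * l ^ j + (q - 1) div l ^ v * k)"
      using \<open>odd y\<close> odd_l even_cofactor[of v] by simp
    ultimately show ?thesis
      using irreducible_two_l_power[of "inverse c" "y * l ^ j + (q - 1) div l ^ v * k" j] c
      by (simp add: B_def y power_add mult.assoc flip: power_mult)
  qed
  have fin: "finite J" "finite R" by (simp_all add: J_def R_def)
  obtain g where g: "g dvd monom 1 N - [:lam:]" "C = gen_code lam N g"
    using code_generator by blast
  obtain \<epsilon> g1 where g1: "\<forall>i. \<epsilon> i \<le> p ^ n" "g = (\<Prod>i<l ^ u. A i ^ \<epsilon> i) * g1"
      "g1 dvd (\<Prod>j\<in>J. \<Prod>k\<in>R. B j k ^ p ^ n) * 1"
    using dvd_prod_irreducible_power_mult[OF finite_lessThan irrA g(1)[unfolded M]] by blast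
  obtain \<sigma> g2 where g2: "\<forall>j k. \<sigma> j k \<le> p ^ n" "g1 = (\<Prod>j\<in>J. \<Prod>k\<in>R. B j k ^ \<sigma> j k) * g2" "is_unit g2"
    using dvd_prod_prod_irreducible_power_mult[OF fin irrB g1(3)] by blast
  have eq: "g = ((\<Prod>i<l ^ u. A i ^ \<epsilon> i) * (\<Prod>j\<in>J. \<Prod>k\<in>R. B j k ^ \<sigma> j k)) * g2"
    unfolding g1(2) g2(2) by (simp only: mult.assoc)
  have "C = gen_code lam N ((\<Prod>i<l ^ u. A i ^ \<epsilon> i) * (\<Prod>j\<in>J. \<Prod>k\<in>R. B j k ^ \<sigma> j k))"
    unfolding g(2) eq gen_code_mult_unit[OF g2(3)] ..
  then show ?thesis
    using g1(1) g2(1) unfolding A_def B_def J_def R_def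
    by (intro exI[of _ \<epsilon>] exI[of _ \<sigma>]) blast
qed

text \<open>Otherwise j would be a positive multiple of l^v below 2 l^v, hence l^v itself, which is
  excluded.\<close>

lemma case_III_exponent:
  assumes "1 \<le> j" "j \<le> 2 * l ^ v - 1" "j \<noteq> l ^ v" "j = y * l ^ z"
  shows "z < v"
proof (rule ccontr)
  assume "\<not> z < v"
  then have "v \<le> z" by (rule leI)
  then have "l ^ v dvd j" unfolding assms(4) by (intro dvd_mult le_imp_power_dvd)
  then obtain k where k: "j = l ^ v * k" by auto
  then have "l ^ v * k < l ^ v * 2" using assms(1,2) by linarith
  then have "k < 2" using nat_mult_less_cancel1 l_pos by simp
  then show False using k assms(1,3) by (cases "k = 0") auto
qed

text \<open>The constant term is an l^z-th power up front, with xi^y left after taking the root. As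
  z < u, the l^z-th roots of unity are both l-th powers and squares, so the new constants inherit
  from xi^y that they are neither.\<close>

lemma case_III_A:
  assumes c: "c \<noteq> 0" "c ^ N * lam = \<xi> ^ (y * l ^ z * p ^ n)"
    and z: "z < v" and y: "coprime y l" "odd y"
  shows "\<exists>\<epsilon>. (\<forall>i. \<epsilon> i \<le> p ^ n) \<and> C = gen_code lam N
    (\<Prod>i<l ^ z. (monom 1 (2 * l ^ (m - z))
      - [:inverse c ^ (2 * l ^ (m - z)) * (\<xi> ^ ((q - 1) div l ^ z)) ^ i * \<xi> ^ y:]) ^ \<epsilon> i)"
proof (rule code_eq_prod)
  have zmu: "z < m" "z < u" using z by auto
  have ly: "\<not> l dvd y" using y(1) prime_l by (metis coprime_absorb_right not_prime_unit)
  have lm: "l ^ (m - z) * l ^ z = l ^ m" using zmu by (simp flip: power_add)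
  show "irreducible (monom 1 (2 * l ^ (m - z))
      - [:inverse c ^ (2 * l ^ (m - z)) * (\<xi> ^ ((q - 1) div l ^ z)) ^ i * \<xi> ^ y:])" for i
  proof -
    have "\<not> l dvd (q - 1) div l ^ z * i + y"
      using ly l_dvd_cofactor[OF zmu(2)] by (simp add: dvd_add_right_iff)
    moreover have "odd ((q - 1) div l ^ z * i + y)"
      using y even_cofactor[of z] zmu by simp
    ultimately show ?thesis
      using irreducible_two_l_power[of "inverse c" "(q - 1) div l ^ z * i + y" "m - z"] c
      by (simp add: power_add mult.assoc flip: power_mult)
  qed
  define b where "b = inverse c ^ (2 * l ^ (m - z)) * \<xi> ^ y"
  have "(\<Prod>i<l ^ z. monom 1 (2 * l ^ (m - z)) - [:b * (\<xi> ^ ((q - 1) div l ^ z)) ^ i:])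
      = monom 1 (2 * l ^ (m - z)) ^ (l ^ z) - [:b ^ (l ^ z):]"
    using l_pos zmu by (intro prod_roots_of_unity primitive_root_of_unity l_power_dvd) auto
  also have "\<dots> = monom 1 (2 * l ^ m) - [:inverse c ^ (2 * l ^ m) * \<xi> ^ (y * l ^ z):]"
    by (simp add: b_def monom_power power_mult_distrib mult.assoc lm flip: power_mult)
  finally show "monom 1 N - [:lam:] = (\<Prod>i<l ^ z. monom 1 (2 * l ^ (m - z))
      - [:inverse c ^ (2 * l ^ (m - z)) * (\<xi> ^ ((q - 1) div l ^ z)) ^ i * \<xi> ^ y:]) ^ (p ^ n)"
    using modulus_eq_power[OF c] by (simp add: b_def mult_ac)
qed simp

text \<open>For even y the constant term is a square and the binomial is a difference of squares
  with root xi^(y/2); l does not divide y/2 because it does not divide y. Both factors have odd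
  degree, so only l-th powers matter.\<close>

lemma case_III_B:
  assumes c: "c \<noteq> 0" "c ^ N * lam = \<xi> ^ (y * l ^ z * p ^ n)"
    and z: "z < v" and y: "coprime y l" "even y"
  shows "\<exists>\<epsilon>1 \<epsilon>2. (\<forall>i::nat. \<epsilon>1 i \<le> p ^ n \<and> \<epsilon>2 i \<le> p ^ n) \<and> C = gen_code lam N
    (\<Prod>i<l ^ z.
       (monom 1 (l ^ (m - z))
         - [:inverse c ^ (l ^ (m - z)) * (\<xi> ^ ((q - 1) div l ^ z)) ^ i * \<xi> ^ (y div 2):]) ^ \<epsilon>1 i
     * (monom 1 (l ^ (m - z))
         + [:inverse c ^ (l ^ (m - z)) * (\<xi> ^ ((q - 1) div l ^ z)) ^ i * \<xi> ^ (y div 2):]) ^ \<epsilon>2 i)"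
proof -
  define \<delta> where "\<delta> = \<xi> ^ ((q - 1) div l ^ z)"
  define b where "b = inverse c ^ (l ^ (m - z)) * \<xi> ^ (y div 2)"
  define A1 where "A1 i = monom 1 (l ^ (m - z)) - [:inverse c ^ (l ^ (m - z)) * \<delta> ^ i * \<xi> ^ (y div 2):]" for i
  define A2 where "A2 i = monom 1 (l ^ (m - z)) + [:inverse c ^ (l ^ (m - z)) * \<delta> ^ i * \<xi> ^ (y div 2):]" for i
  have zmu: "z < m" "z < u" using z by auto
  have ly: "\<not> l dvd y" using y(1) prime_l by (metis coprime_absorb_right not_prime_unit)
  have lm: "l ^ (m - z) * l ^ z = l ^ m" using zmu by (simp flip: power_add)
  have irr: "irreducible (A1 i)" "irreducible (A2 i)" for i
  proof -
    have "\<not> l dvd y div 2" using ly y(2) by (metis dvd_div_mult_self dvd_mult2)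
    then have "\<not> l dvd (q - 1) div l ^ z * i + y div 2"
      using l_dvd_cofactor[OF zmu(2)] by (simp add: dvd_add_right_iff)
    then show "irreducible (A1 i)" "irreducible (A2 i)"
      using irreducible_l_power[of "inverse c" "m - z" "(q - 1) div l ^ z * i + y div 2"]
        irreducible_l_power_plus[of "inverse c" "m - z" "(q - 1) div l ^ z * i + y div 2"] c
      by (simp_all add: A1_def A2_def \<delta>_def power_add mult.assoc flip: power_mult)
  qed
  have root: "(\<Prod>i<l ^ z. monom 1 (l ^ (m - z)) - [:b' * \<delta> ^ i:]) = monom 1 (l ^ m) - [:b' ^ (l ^ z):]" for b'
  proof -
    have "(\<Prod>i<l ^ z. monom 1 (l ^ (m - z)) - [:b' * \<delta> ^ i:]) = monom 1 (l ^ (m - z)) ^ (l ^ z) - [:b' ^ (l ^ z):]"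
      unfolding \<delta>_def using l_pos zmu by (intro prod_roots_of_unity primitive_root_of_unity l_power_dvd) auto
    then show ?thesis by (simp add: monom_power lm)
  qed
  have 1: "(\<Prod>i<l ^ z. A1 i) = monom 1 (l ^ m) - [:b ^ (l ^ z):]"
    using root[of b] by (simp add: A1_def b_def mult_ac)
  have 2: "(\<Prod>i<l ^ z. A2 i) = monom 1 (l ^ m) + [:b ^ (l ^ z):]"
    using root[of "- b"] odd_l by (simp add: A2_def b_def mult_ac diff_uminus_const_poly)
  have "b ^ (l ^ z) * b ^ (l ^ z) = (b * b) ^ (l ^ z)" by (simp add: power_mult_distrib)
  also have "b * b = inverse c ^ (2 * l ^ (m - z)) * \<xi> ^ y"
    using y(2) by (auto simp: b_def mult_2 power_add elim!: evenE)
  also have "\<dots> ^ (l ^ z) = inverse c ^ (2 * l ^ m) * \<xi> ^ (y * l ^ z)"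
    by (simp add: power_mult_distrib mult.assoc lm flip: power_mult)
  finally have bb: "b ^ (l ^ z) * b ^ (l ^ z) = inverse c ^ (2 * l ^ m) * \<xi> ^ (y * l ^ z)" .
  have "(\<Prod>i<l ^ z. A1 i) * (\<Prod>i<l ^ z. A2 i) = monom 1 (l ^ m) * monom 1 (l ^ m) - [:b ^ (l ^ z) * b ^ (l ^ z):]"
    unfolding 1 2 by (simp add: algebra_simps)
  also have "\<dots> = monom 1 (2 * l ^ m) - [:inverse c ^ (2 * l ^ m) * \<xi> ^ (y * l ^ z):]"
    unfolding bb by (simp add: mult_monom mult_2)
  finally have "monom 1 N - [:lam:] = ((\<Prod>i<l ^ z. A1 i) * (\<Prod>i<l ^ z. A2 i)) ^ (p ^ n)"
    using modulus_eq_power[OF c] by (simp only:)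
  then have M: "monom 1 N - [:lam:] = (\<Prod>i<l ^ z. A1 i ^ p ^ n) * ((\<Prod>i<l ^ z. A2 i ^ p ^ n) * 1)"
    by (simp only: power_mult_distrib prod_power_distrib mult_1_right)
  obtain g where g: "g dvd monom 1 N - [:lam:]" "C = gen_code lam N g"
    using code_generator by blast
  obtain \<epsilon>1 g1 where g1: "\<forall>i. \<epsilon>1 i \<le> p ^ n" "g = (\<Prod>i<l ^ z. A1 i ^ \<epsilon>1 i) * g1"
      "g1 dvd (\<Prod>i<l ^ z. A2 i ^ p ^ n) * 1"
    using dvd_prod_irreducible_power_mult[OF finite_lessThan irr(1) g(1)[unfolded M]] by blast
  obtain \<epsilon>2 g2 where g2: "\<forall>i. \<epsilon>2 i \<le> p ^ n" "g1 = (\<Prod>i<l ^ z. A2 i ^ \<epsilon>2 i) * g2" "is_unit g2"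
    using dvd_prod_irreducible_power_mult[OF finite_lessThan irr(2) g1(3)] by blast
  have eq: "g = (\<Prod>i<l ^ z. A1 i ^ \<epsilon>1 i * A2 i ^ \<epsilon>2 i) * g2"
    unfolding g1(2) g2(2) by (simp only: prod.distrib mult.assoc)
  have "C = gen_code lam N (\<Prod>i<l ^ z. A1 i ^ \<epsilon>1 i * A2 i ^ \<epsilon>2 i)"
    unfolding g(2) eq gen_code_mult_unit[OF g2(3)] ..
  then show ?thesis
    using g1(1) g2(1) unfolding A1_def A2_def \<delta>_def
    by (intro exI[of _ \<epsilon>1] exI[of _ \<epsilon>2]) blast
qed

end

theorem theorem3p3:
  fixes p q s l m n u :: nat and \<xi> lam :: "'a::{finite,field}" and C :: "'a list set"
  assumes hp: "prime p" and hpodd: "odd p"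
    and hq: "q = p ^ s" and hcard: "card (UNIV :: 'a set) = q"
    and hgen: "\<xi> \<noteq> 0" "\<forall>x::'a. x \<noteq> 0 \<longrightarrow> (\<exists>k::nat. x = \<xi> ^ k)"
    and hl: "prime l" "odd l" "l \<noteq> p" "l dvd q - 1"
    and hm: "m > 0" and hn: "n > 0"
    and hu: "l ^ u dvd q - 1" "\<not> l ^ (u + 1) dvd q - 1"
    and hlam: "lam \<noteq> 0"
    and hC: "constacyclic_code lam (2 * l ^ m * p ^ n) C"
  shows
   "let N = 2 * l ^ m * p ^ n; v = min m u; \<zeta> = \<xi> ^ ((q - 1) div l ^ v) in
    (lam \<in> cyc (\<xi> ^ (2 * l ^ v)) \<and>
      (\<exists>c1. c1 \<noteq> 0 \<and> c1 ^ N * lam = 1 \<and>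
        (\<exists>(\<epsilon>1 :: nat \<Rightarrow> nat) (\<epsilon>2 :: nat \<Rightarrow> nat) (\<tau> :: nat \<Rightarrow> nat \<Rightarrow> nat) (\<sigma> :: nat \<Rightarrow> nat \<Rightarrow> nat).
           (\<forall>i. \<epsilon>1 i \<le> p ^ n \<and> \<epsilon>2 i \<le> p ^ n) \<and>
           (\<forall>j k. \<tau> j k \<le> p ^ n \<and> \<sigma> j k \<le> p ^ n) \<and>
           C = gen_code lam N
             ((\<Prod>i<l ^ v. [:- (inverse c1 * \<zeta> ^ i), 1:] ^ \<epsilon>1 i
                            * [:inverse c1 * \<zeta> ^ i, 1:] ^ \<epsilon>2 i) *
              (\<Prod>j\<in>{1..m - u}. \<Prod>k\<in>{k\<in>{1..l ^ v}. \<not> l dvd k}.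
                 (monom 1 (l ^ j) - [:inverse c1 ^ (l ^ j) * \<zeta> ^ k:]) ^ \<tau> j k
                 * (monom 1 (l ^ j) + [:inverse c1 ^ (l ^ j) * \<zeta> ^ k:]) ^ \<sigma> j k)))))
    \<or>
    (lam \<in> coset (\<xi> ^ (l ^ v * p ^ n)) (\<xi> ^ (2 * l ^ v)) \<and>
      (\<exists>c2. c2 \<noteq> 0 \<and> c2 ^ N * lam = \<xi> ^ (l ^ v * p ^ n) \<and>
        (m \<le> u \<longrightarrow>
          (let \<alpha> = \<xi> ^ ((q - 1) div l ^ m) in
           \<exists>\<epsilon> :: nat \<Rightarrow> nat. (\<forall>i. \<epsilon> i \<le> p ^ n) \<and>
             C = gen_code lam N
               (\<Prod>i<l ^ m. (monom 1 2 - [:inverse c2 ^ 2 * \<xi> * \<alpha> ^ i:]) ^ \<epsilon> i))) \<and>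
        (m > u \<longrightarrow>
          (\<exists>\<beta>. \<beta> \<in> cyc (\<xi> ^ (l ^ u)) \<and> \<beta> ^ (l ^ m) * \<xi> ^ (l ^ u) = 1 \<and>
           (\<exists>(\<epsilon> :: nat \<Rightarrow> nat) (\<sigma> :: nat \<Rightarrow> nat \<Rightarrow> nat).
             (\<forall>i. \<epsilon> i \<le> p ^ n) \<and> (\<forall>j k. \<sigma> j k \<le> p ^ n) \<and>
             C = gen_code lam N
               ((\<Prod>i<l ^ u. (monom 1 2 - [:inverse c2 ^ 2 * inverse \<beta> * \<zeta> ^ i:]) ^ \<epsilon> i) *
                (\<Prod>j\<in>{1..m - u}. \<Prod>k\<in>{k\<in>{1..l ^ u}. \<not> l dvd k}.
                   (monom 1 (2 * l ^ j)
                     - [:inverse c2 ^ (2 * l ^ j) * inverse \<beta> ^ (l ^ j) * \<zeta> ^ k:]) ^ \<sigma> j k)))))))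
    \<or>
    (\<exists>j. 1 \<le> j \<and> j \<le> 2 * l ^ v - 1 \<and> j \<noteq> l ^ v \<and>
      lam \<in> coset (\<xi> ^ (j * p ^ n)) (\<xi> ^ (2 * l ^ v)) \<and>
      (\<exists>d1. d1 \<noteq> 0 \<and> d1 ^ N * lam = \<xi> ^ (j * p ^ n) \<and>
        (\<forall>y z. j = y * l ^ z \<and> coprime y l \<longrightarrow>
          z \<le> v - 1 \<and>
          (let \<delta> = \<xi> ^ ((q - 1) div l ^ z) in
            (odd y \<longrightarrow>
              (\<exists>\<epsilon> :: nat \<Rightarrow> nat. (\<forall>i. \<epsilon> i \<le> p ^ n) \<and>
                C = gen_code lam N
                  (\<Prod>i<l ^ z. (monom 1 (2 * l ^ (m - z))
                      - [:inverse d1 ^ (2 * l ^ (m - z)) * \<delta> ^ i * \<xi> ^ y:]) ^ \<epsilon> i))) \<and>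
            (even y \<longrightarrow>
              (\<exists>\<epsilon>1 \<epsilon>2 :: nat \<Rightarrow> nat. (\<forall>i. \<epsilon>1 i \<le> p ^ n \<and> \<epsilon>2 i \<le> p ^ n) \<and>
                C = gen_code lam N
                  (\<Prod>i<l ^ z.
                     (monom 1 (l ^ (m - z))
                       - [:inverse d1 ^ (l ^ (m - z)) * \<delta> ^ i * \<xi> ^ (y div 2):]) ^ \<epsilon>1 i
                   * (monom 1 (l ^ (m - z))
                       + [:inverse d1 ^ (l ^ (m - z)) * \<delta> ^ i * \<xi> ^ (y div 2):]) ^ \<epsilon>2 i)))))))"
proof -
  interpret constacyclic_setting \<xi> q p s l m n u lam C
    using assms by unfold_locales auto
  obtain j where j: "j < 2 * l ^ v" "lam \<in> coset (\<xi> ^ (j * p ^ n)) (\<xi> ^ (2 * l ^ v))"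
    using ex_coset by blast
  obtain c where c: "c \<noteq> 0" "c ^ N * lam = \<xi> ^ (j * p ^ n)"
    using ex_scaling[OF j(2)] by blast
  \<comment> \<open>The multiples of l^v among the representatives are 0 and l^v; all the others
    have l-adic valuation below v.\<close>
  consider "j = 0" | "j = l ^ v" | "1 \<le> j" "j \<le> 2 * l ^ v - 1" "j \<noteq> l ^ v"
    using j(1) by linarith
  then show ?thesis
  proof cases
    case 1
    have "lam \<in> cyc (\<xi> ^ (2 * l ^ v))"
      using j(2) unfolding 1 by (simp add: coset_def)
    moreover have "c ^ N * lam = 1" using c(2) unfolding 1 by simp
    ultimately show ?thesis
      unfolding Let_def using c(1) case_I[OF c(1)] by (intro disjI1 conjI exI[of _ c])
  next
    case 2
    obtain \<beta> where \<beta>: "\<beta> \<in> cyc (\<xi> ^ (l ^ u))" "\<beta> ^ (l ^ m) * \<xi> ^ (l ^ u) = 1"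
      using ex_beta by blast
    show ?thesis
      unfolding Let_def
      by (rule disjI2, rule disjI1, rule conjI, rule j(2)[unfolded 2], rule exI[of _ c],
          intro conjI impI exI[of _ \<beta>] c[unfolded 2] \<beta>
            case_II_A[OF c[unfolded 2]] case_II_B[OF c[unfolded 2] _ \<beta>(2)])
  next
    case 3
    have III: "z \<le> v - 1 \<and>
        (odd y \<longrightarrow> (\<exists>\<epsilon>. (\<forall>i. \<epsilon> i \<le> p ^ n) \<and> C = gen_code lam N
          (\<Prod>i<l ^ z. (monom 1 (2 * l ^ (m - z))
            - [:inverse c ^ (2 * l ^ (m - z)) * (\<xi> ^ ((q - 1) div l ^ z)) ^ i * \<xi> ^ y:]) ^ \<epsilon> i))) \<and>
        (even y \<longrightarrow> (\<exists>\<epsilon>1 \<epsilon>2. (\<forall>i. \<epsilon>1 i \<le> p ^ n \<and> \<epsilon>2 i \<le> p ^ n) \<and> C = gen_code lam N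
          (\<Prod>i<l ^ z.
             (monom 1 (l ^ (m - z))
               - [:inverse c ^ (l ^ (m - z)) * (\<xi> ^ ((q - 1) div l ^ z)) ^ i * \<xi> ^ (y div 2):]) ^ \<epsilon>1 i
           * (monom 1 (l ^ (m - z))
               + [:inverse c ^ (l ^ (m - z)) * (\<xi> ^ ((q - 1) div l ^ z)) ^ i * \<xi> ^ (y div 2):]) ^ \<epsilon>2 i)))"
      if yz: "j = y * l ^ z \<and> coprime y l" for y z
    proof -
      have z: "z < v" using case_III_exponent[OF 3] yz by blast
      have c': "c ^ N * lam = \<xi> ^ (y * l ^ z * p ^ n)" using c(2) yz by simp
      have "z \<le> v - 1" using z by linarith
      then show ?thesis
        using case_III_A[OF c(1) c' z] case_III_B[OF c(1) c' z] yz by blast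
    qed
    show ?thesis
      unfolding Let_def
      by (rule disjI2, rule disjI2, rule exI[of _ j], rule conjI[OF 3(1)], rule conjI[OF 3(2)],
          rule conjI[OF 3(3)], rule conjI[OF j(2)], rule exI[of _ c], rule conjI[OF c(1)],
          rule conjI[OF c(2)], intro allI impI, rule III)
  qed
qed

end
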